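(* Let $n\ge2$ and $1<p,q\le\infty$, and let $1/q+1/q'=1$. Then the trace operator $\mathrm{Tr}: f(x)\mapsto f(\bar x,0)$, $\bar x=(x_1,\dots,x_{n-1})$, is not bounded from $M^{1/q'}_{p,q}(\mathbb{R}^n)$ to $M^0_{p,q}(\mathbb{R}^{n-1})$: there is no constant $C>0$ such that $\mathrm{Tr}f$ is defined and $\|\mathrm{Tr} f\|_{M^0_{p,q}(\mathbb{R}^{n-1})}\le C\|f\|_{M^{1/q'}_{p,q}(\mathbb{R}^n)}$ for all $f\in M^{1/q'}_{p,q}(\mathbb{R}^n)$.
   Context: Notation: $\langle x\rangle=(1+|x|^2)^{1/2}$; $\mathscr{F},\mathscr{F}^{-1}$ are the Fourier transform and its inverse. Frequency-uniform decomposition: let $\eta:\mathbb{R}\to[0,1]$ be a smooth function with $\eta(t)=1$ for $|t|\le1$ and $\eta(t)=0$ for $|t|\ge2$. In dimension $d$, for $k\in\mathbb{Z}^d$ put $$\psi_k(\xi)=\frac{\prod_{i=1}^d\eta(2(\xi_i-k_i))}{\sum_{m\in\mathbb{Z}^d}\prod_{i=1}^d\eta(2(\xi_i-m_i))},\qquad \Box_k=\mathscr{F}^{-1}\psi_k\mathscr{F}.$$ Modulation space $M^s_{p,q}(\mathbb{R}^d)$: all tempered distributions $f$ with $$\|f\|_{M^s_{p,q}}=\Big(\sum_{k\in\mathbb{Z}^d}\langle k\rangle^{qs}\|\Box_kf\|_{L^p(\mathbb{R}^d)}^q\Big)^{1/q}<\infty$$ (supremum if $q=\infty$). Trace: for a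 tempered distribution $f$, $f(\bar x,0)$ is understood as $\sum_{k\in\mathbb{Z}^n}(\Box_kf)(\bar x,0)$ whenever this converges in $\mathscr{S}'(\mathbb{R}^{n-1})$; for a Schwartz function $f$ it is the ordinary restriction. *)

theory Defs
  imports "HOL-Analysis.Analysis" "HOL-Probability.Essential_Supremum"
begin

definition japanese :: "'a::euclidean_space \<Rightarrow> real" where
  "japanese x = sqrt (1 + (norm x)\<^sup>2)"

definition int_lattice :: "'a::euclidean_space set" where
  "int_lattice = {k. \<forall>b\<in>Basis. k \<bullet> b \<in> \<int>}"


section \<open>Schwartz functions and tempered distributions\<close>

primrec iter_pderiv ::
  "'a list \<Rightarrow> ('a::euclidean_space \<Rightarrow> 'b::real_normed_vector) \<Rightarrow> 'a \<Rightarrow> 'b" where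
  "iter_pderiv [] f = f"
| "iter_pderiv (b # bs) f = (\<lambda>x. frechet_derivative (iter_pderiv bs f) (at x) b)"

definition smooth :: "('a::euclidean_space \<Rightarrow> 'b::real_normed_vector) \<Rightarrow> bool" where
  "smooth f \<longleftrightarrow> (\<forall>bs\<in>lists Basis. \<forall>x. iter_pderiv bs f differentiable (at x))"

definition schwartz :: "('a::euclidean_space \<Rightarrow> complex) \<Rightarrow> bool" where
  "schwartz \<phi> \<longleftrightarrow> smooth \<phi> \<and>
     (\<forall>bs\<in>lists Basis. \<forall>N::nat. bdd_above (range (\<lambda>x. japanese x ^ N * cmod (iter_pderiv bs \<phi> x))))"

definition schwartz_norm :: "nat \<Rightarrow> ('a::euclidean_space \<Rightarrow> complex) \<Rightarrow> real" where
  "schwartz_norm N \<phi> =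
     (\<Sum>bs\<in>{bs \<in> lists Basis. length bs \<le> N}. SUP x. japanese x ^ N * cmod (iter_pderiv bs \<phi> x))"

text \<open>Distributions are functionals on all functions \<open>'a \<Rightarrow> complex\<close>, but only their
  values at Schwartz functions are ever meaningful: two functionals that agree on Schwartz
  functions stand for the same distribution.\<close>

type_synonym 'a distribution = "('a \<Rightarrow> complex) \<Rightarrow> complex"

definition tempered :: "'a::euclidean_space distribution \<Rightarrow> bool" where
  "tempered T \<longleftrightarrow>
     (\<forall>\<phi> \<theta>. schwartz \<phi> \<longrightarrow> schwartz \<theta> \<longrightarrow> T (\<lambda>x. \<phi> x + \<theta> x) = T \<phi> + T \<theta>) \<and>
     (\<forall>c \<phi>. schwartz \<phi> \<longrightarrow> T (\<lambda>x. c * \<phi> x) = c * T \<phi>) \<and>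
     (\<exists>C N. \<forall>\<phi>. schwartz \<phi> \<longrightarrow> cmod (T \<phi>) \<le> C * schwartz_norm N \<phi>)"

definition pairing :: "('a::euclidean_space \<Rightarrow> complex) \<Rightarrow> 'a distribution" where
  "pairing g \<phi> = (LINT x|lborel. g x * \<phi> x)"

text \<open>The integrability clause matters: the Bochner integral of a non-integrable function is 0.\<close>

definition represents :: "('a::euclidean_space \<Rightarrow> complex) \<Rightarrow> 'a distribution \<Rightarrow> bool" where
  "represents g T \<longleftrightarrow>
     (\<forall>\<phi>. schwartz \<phi> \<longrightarrow> integrable lborel (\<lambda>x. g x * \<phi> x) \<and> T \<phi> = pairing g \<phi>)"


section \<open>Fourier transform\<close>

definition fourier :: "('a::euclidean_space \<Rightarrow> complex) \<Rightarrow> 'a \<Rightarrow> complex" where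
  "fourier \<phi> \<xi> = (LINT x|lborel. cis (- (x \<bullet> \<xi>)) * \<phi> x)"

definition inv_fourier :: "('a::euclidean_space \<Rightarrow> complex) \<Rightarrow> 'a \<Rightarrow> complex" where
  "inv_fourier \<phi> x =
     complex_of_real (1 / (2 * pi) ^ DIM('a)) * (LINT \<xi>|lborel. cis (x \<bullet> \<xi>) * \<phi> \<xi>)"

definition dist_fourier :: "'a::euclidean_space distribution \<Rightarrow> 'a distribution" where
  "dist_fourier T = (\<lambda>\<phi>. T (fourier \<phi>))"

definition dist_inv_fourier :: "'a::euclidean_space distribution \<Rightarrow> 'a distribution" where
  "dist_inv_fourier T = (\<lambda>\<phi>. T (inv_fourier \<phi>))"

definition dist_mult :: "('a \<Rightarrow> real) \<Rightarrow> 'a distribution \<Rightarrow> 'a distribution" where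
  "dist_mult m T = (\<lambda>\<phi>. T (\<lambda>x. complex_of_real (m x) * \<phi> x))"


section \<open>Frequency-uniform decomposition\<close>

definition bump :: "(real \<Rightarrow> real) \<Rightarrow> bool" where
  "bump \<eta> \<longleftrightarrow> smooth \<eta> \<and> (\<forall>t. 0 \<le> \<eta> t \<and> \<eta> t \<le> 1) \<and>
     (\<forall>t. \<bar>t\<bar> \<le> 1 \<longrightarrow> \<eta> t = 1) \<and> (\<forall>t. \<bar>t\<bar> \<ge> 2 \<longrightarrow> \<eta> t = 0)"

definition cube_bump :: "(real \<Rightarrow> real) \<Rightarrow> 'a::euclidean_space \<Rightarrow> 'a \<Rightarrow> real" where
  "cube_bump \<eta> k \<xi> = (\<Prod>b\<in>Basis. \<eta> (2 * (\<xi> \<bullet> b - k \<bullet> b)))"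

definition psi :: "(real \<Rightarrow> real) \<Rightarrow> 'a::euclidean_space \<Rightarrow> 'a \<Rightarrow> real" where
  "psi \<eta> k \<xi> = cube_bump \<eta> k \<xi> / (\<Sum>\<^sub>\<infinity>m\<in>int_lattice. cube_bump \<eta> m \<xi>)"

definition box_op ::
  "(real \<Rightarrow> real) \<Rightarrow> 'a::euclidean_space \<Rightarrow> 'a distribution \<Rightarrow> 'a distribution" where
  "box_op \<eta> k T = dist_inv_fourier (dist_mult (psi \<eta> k) (dist_fourier T))"

text \<open>For tempered \<open>T\<close>, \<open>box_op \<eta> k T\<close> has compactly supported Fourier transform, hence is
  (uniquely) represented by a continuous, in fact analytic, function of polynomial growth.
  This function is what the \<open>L\<^sup>p\<close> norms and the restriction to a hyperplane refer to.\<close>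

definition box_fun ::
  "(real \<Rightarrow> real) \<Rightarrow> 'a::euclidean_space \<Rightarrow> 'a distribution \<Rightarrow> 'a \<Rightarrow> complex" where
  "box_fun \<eta> k T = (THE g. continuous_on UNIV g \<and> represents g (box_op \<eta> k T))"


section \<open>Modulation spaces\<close>

text \<open>Real powers of extended nonnegative numbers, for exponents \<open>a > 0\<close>.\<close>

definition enn_powr :: "ennreal \<Rightarrow> real \<Rightarrow> ennreal" where
  "enn_powr x a = (if x = \<infinity> then \<infinity> else ennreal (enn2real x powr a))"

definition Lp_norm :: "ennreal \<Rightarrow> ('a::euclidean_space \<Rightarrow> complex) \<Rightarrow> ennreal" where
  "Lp_norm p g =
     (if p = \<infinity> then esssup lborel (\<lambda>x. ennreal (cmod (g x)))
      else enn_powr (\<integral>\<^sup>+ x. ennreal (cmod (g x) powr enn2real p) \<partial>lborel) (1 / enn2real p))"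

definition mod_norm ::
  "(real \<Rightarrow> real) \<Rightarrow> ennreal \<Rightarrow> ennreal \<Rightarrow> real \<Rightarrow> 'a::euclidean_space distribution \<Rightarrow> ennreal" where
  "mod_norm \<eta> p q s f =
     (if q = \<infinity> then (SUP k\<in>int_lattice. ennreal (japanese k powr s) * Lp_norm p (box_fun \<eta> k f))
      else enn_powr
        (\<Sum>\<^sub>\<infinity>k\<in>int_lattice.
           ennreal (japanese k powr (enn2real q * s)) * enn_powr (Lp_norm p (box_fun \<eta> k f)) (enn2real q))
        (1 / enn2real q))"

definition mod_space ::
  "(real \<Rightarrow> real) \<Rightarrow> ennreal \<Rightarrow> ennreal \<Rightarrow> real \<Rightarrow> 'a::euclidean_space distribution set" where
  "mod_space \<eta> p q s = {f. tempered f \<and> mod_norm \<eta> p q s f < \<infinity>}"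


section \<open>Trace\<close>

text \<open>\<open>\<real>\<^sup>n\<close> is the Euclidean space \<open>'a \<times> real\<close> with \<open>'a\<close> of dimension \<open>n - 1\<close>, so that the
  hyperplane \<open>x\<^sub>n = 0\<close> is the range of \<open>\<lambda>x. (x, 0)\<close>. The series over the lattice is summed
  unconditionally, in the weak-* topology of the tempered distributions.\<close>

definition trace_term ::
  "(real \<Rightarrow> real) \<Rightarrow> ('a::euclidean_space \<times> real) distribution \<Rightarrow> 'a \<times> real \<Rightarrow> 'a distribution" where
  "trace_term \<eta> f k = pairing (\<lambda>x. box_fun \<eta> k f (x, 0))"

definition Tr ::
  "(real \<Rightarrow> real) \<Rightarrow> ('a::euclidean_space \<times> real) distribution \<Rightarrow> 'a distribution" where
  "Tr \<eta> f = (\<lambda>\<phi>. \<Sum>\<^sub>\<infinity>k\<in>int_lattice. trace_term \<eta> f k \<phi>)"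

definition trace_defined ::
  "(real \<Rightarrow> real) \<Rightarrow> ('a::euclidean_space \<times> real) distribution \<Rightarrow> bool" where
  "trace_defined \<eta> f \<longleftrightarrow>
     (\<forall>\<phi>. schwartz \<phi> \<longrightarrow> (\<lambda>k. trace_term \<eta> f k \<phi>) summable_on int_lattice) \<and> tempered (Tr \<eta> f)"

end

theory Submission
  imports Defs "HOL-Probability.Characteristic_Functions" "HOL-Probability.Sinc_Integral"
begin

text \<open>Let \<open>g\<close> be the function with Fourier transform \<open>\<psi>\<^sub>0\<close>, smooth and compactly supported, and put
  \<open>f\<^sub>N = \<Sum>\<^sub>j\<^sub>\<le>\<^sub>N j\<^sup>-\<^sup>1 exp(i j x\<^sub>n) g\<close>, a superposition of wave packets with frequencies near \<open>(0, j)\<close>.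
  Restricting to \<open>x\<^sub>n = 0\<close> destroys the frequency separation, so the trace is \<open>H\<^sub>N\<close> times a fixed
  function, \<open>H\<^sub>N\<close> being the harmonic number. In the modulation norm with weight \<open>1/q'\<close> the packets
  are almost orthogonal, and \<open>j\<^bsup>q/q'\<^esup> j\<^bsup>-q\<^esup> = j\<^sup>-\<^sup>1\<close> gives a norm of size \<open>H\<^sub>N\<^bsup>1/q\<^esup>\<close>. Since \<open>q > 1\<close>,
  no constant can dominate \<open>H\<^sub>N / H\<^sub>N\<^bsup>1/q\<^esup>\<close>.

  Since \<open>\<psi>\<^sub>k\<close> is a tensor product of translates of one function on the line, all the Fourier analysis
  reduces to dimension one.\<close>


section \<open>A \<open>C\<^sup>2\<close> partition of unity on the line\<close>

text \<open>Two derivatives of the profile are enough: they bound the packets by a multiple of the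
  product of 1 / (1 + x_b^2), which is bounded and integrable, hence in every L^p, and they make
  Fourier inversion available on the line. The packets are therefore never shown to be Schwartz
  functions. The price is that functionals must be known on more than Schwartz functions:
  \<open>box_op\<close> applies its argument to the transform of a cut-off function, of which only
  continuity and boundedness are established. Every functional, the trace included, is thus
  identified on all bounded continuous functions. Since the pieces \<open>box_fun\<close> are given
  by a definite description, uniqueness of continuous representatives has to be proved too. The
  single exponent \<tau> = 1/q, read as 0 for q = \<infinity>, treats all q alike: on cells near the
  axis, weight times L^p norm is at most a constant times (k_n + 1)^(-\<tau>), and finite overlap
  turns this into H_N^\<tau>. For the trace, the cell k = 0 alone gives the lower bound.\<close>

definition C2 :: "(real \<Rightarrow> real) \<Rightarrow> bool" where
  "C2 f \<longleftrightarrow> (\<exists>f1 f2. (\<forall>t. (f has_real_derivative f1 t) (at t)) \<and>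
     (\<forall>t. (f1 has_real_derivative f2 t) (at t)) \<and> continuous_on UNIV f2)"

lemma C2I:
  assumes "\<And>t. (f has_real_derivative f1 t) (at t)"
    and "\<And>t. (f1 has_real_derivative f2 t) (at t)" and "continuous_on UNIV f2"
  shows "C2 f"
  using assms unfolding C2_def by blast

lemma C2_continuous: "C2 f \<Longrightarrow> continuous_on A f"
  unfolding C2_def by (meson DERIV_isCont continuous_at_imp_continuous_on)

lemma C2_const: "C2 (\<lambda>t. c)"
  by (rule C2I[of _ "\<lambda>t. 0" "\<lambda>t. 0"]) (auto intro!: derivative_eq_intros)

lemma C2_add: assumes "C2 f" "C2 g" shows "C2 (\<lambda>t. f t + g t)"
proof -
  obtain f1 f2 g1 g2 where
    *: "\<And>t. (f has_real_derivative f1 t) (at t)" "\<And>t. (f1 has_real_derivative f2 t) (at t)"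
      "continuous_on UNIV f2"
      "\<And>t. (g has_real_derivative g1 t) (at t)" "\<And>t. (g1 has_real_derivative g2 t) (at t)"
      "continuous_on UNIV g2"
    using assms unfolding C2_def by blast
  show ?thesis
    by (rule C2I[of _ "\<lambda>t. f1 t + g1 t" "\<lambda>t. f2 t + g2 t"]) (auto intro!: DERIV_add continuous_intros *)
qed

lemma C2_sum: "(\<And>i. i \<in> I \<Longrightarrow> C2 (f i)) \<Longrightarrow> C2 (\<lambda>t. \<Sum>i\<in>I. f i t)"
  by (induction I rule: infinite_finite_induct) (auto intro: C2_const C2_add)

lemma C2_mult: assumes "C2 f" "C2 g" shows "C2 (\<lambda>t. f t * g t)"
proof -
  obtain f1 f2 g1 g2 where
    *: "\<And>t. (f has_real_derivative f1 t) (at t)" "\<And>t. (f1 has_real_derivative f2 t) (at t)"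
      "continuous_on UNIV f2"
      "\<And>t. (g has_real_derivative g1 t) (at t)" "\<And>t. (g1 has_real_derivative g2 t) (at t)"
      "continuous_on UNIV g2"
    using assms unfolding C2_def by blast
  have c: "continuous_on UNIV f" "continuous_on UNIV g" "continuous_on UNIV f1" "continuous_on UNIV g1"
    using * by (meson DERIV_isCont continuous_at_imp_continuous_on)+
  show ?thesis
    by (rule C2I[of _ "\<lambda>t. f1 t * g t + f t * g1 t" "\<lambda>t. f2 t * g t + 2 * (f1 t * g1 t) + f t * g2 t"])
      (auto intro!: derivative_eq_intros * continuous_intros c simp: algebra_simps)
qed

lemma C2_inverse: assumes "C2 f" "\<And>t. f t \<noteq> 0" shows "C2 (\<lambda>t. inverse (f t))"
proof -
  obtain f1 f2 where
    *: "\<And>t. (f has_real_derivative f1 t) (at t)" "\<And>t. (f1 has_real_derivative f2 t) (at t)"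
      "continuous_on UNIV f2"
    using assms unfolding C2_def by blast
  have c: "continuous_on UNIV f" "continuous_on UNIV f1"
    using * by (meson DERIV_isCont continuous_at_imp_continuous_on)+
  show ?thesis
  proof (rule C2I[of _ "\<lambda>t. - f1 t / (f t)^2" "\<lambda>t. - f2 t / (f t)^2 + 2 * (f1 t)^2 / (f t)^3"])
    show "((\<lambda>t. inverse (f t)) has_real_derivative - f1 t / (f t)\<^sup>2) (at t)" for t
      by (rule derivative_eq_intros * assms)+ (use assms in \<open>simp add: power2_eq_square divide_simps\<close>)
    show "((\<lambda>t. - f1 t / (f t)\<^sup>2) has_real_derivative - f2 t / (f t)\<^sup>2 + 2 * (f1 t)\<^sup>2 / f t ^ 3) (at t)" for t
      by (rule derivative_eq_intros refl * assms | simp add: assms)+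
        (simp add: power2_eq_square power3_eq_cube power4_eq_xxxx divide_simps assms algebra_simps)
  qed (auto intro!: continuous_intros c * simp: assms)
qed

lemma C2_divide: "C2 f \<Longrightarrow> C2 g \<Longrightarrow> (\<And>t. g t \<noteq> 0) \<Longrightarrow> C2 (\<lambda>t. f t / g t)"
  by (simp add: divide_inverse C2_mult C2_inverse)

lemma C2_affine: assumes "C2 f" shows "C2 (\<lambda>t. f (a * t + b))"
proof -
  obtain f1 f2 where
    *: "\<And>t. (f has_real_derivative f1 t) (at t)" "\<And>t. (f1 has_real_derivative f2 t) (at t)"
      "continuous_on UNIV f2"
    using assms unfolding C2_def by blast
  have l: "((\<lambda>t. a * t + b) has_real_derivative a) (at t)" for t
    by (auto intro!: derivative_eq_intros)
  show ?thesis
  proof (rule C2I[of _ "\<lambda>t. f1 (a * t + b) * a" "\<lambda>t. f2 (a * t + b) * a * a"])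
    show "((\<lambda>t. f (a * t + b)) has_real_derivative f1 (a * t + b) * a) (at t)" for t
      using DERIV_chain2[OF *(1) l] .
    show "((\<lambda>t. f1 (a * t + b) * a) has_real_derivative f2 (a * t + b) * a * a) (at t)" for t
      using DERIV_cmult_right[OF DERIV_chain2[OF *(2) l]] .
    show "continuous_on UNIV (\<lambda>t. f2 (a * t + b) * a * a)"
      by (intro continuous_intros continuous_on_compose2[OF *(3)]) auto
  qed
qed

text \<open>Serves \<open>per\<close>, whose range of summation jumps with the floor of t. Taking
  \<open>deriv\<close> twice gives globally defined candidates, so the local derivatives agree with
  them and need no gluing.\<close>

lemma C2_local:
  assumes "\<And>t. \<exists>g S. C2 g \<and> open S \<and> t \<in> S \<and> (\<forall>s\<in>S. f s = g s)"
  shows "C2 f"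
proof -
  define f1 where "f1 = deriv f"
  define f2 where "f2 = deriv f1"
  have loc: "\<exists>S. open S \<and> t \<in> S \<and> (\<forall>s\<in>S. (f has_real_derivative f1 s) (at s) \<and>
      (f1 has_real_derivative f2 s) (at s)) \<and> continuous_on S f2" for t
  proof -
    obtain g S g1 g2 where S: "open S" "t \<in> S" "\<And>s. s \<in> S \<Longrightarrow> f s = g s"
      and g: "\<And>t. (g has_real_derivative g1 t) (at t)" "\<And>t. (g1 has_real_derivative g2 t) (at t)"
        "continuous_on UNIV g2"
      using assms[of t] unfolding C2_def by blast
    have a: "(f has_real_derivative g1 s) (at s)" if "s \<in> S" for s
      using has_field_derivative_transform_within_open[OF g(1) S(1) that, of f] S(3) by simp
    have a': "f1 s = g1 s" if "s \<in> S" for s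
      unfolding f1_def using a[OF that] by (rule DERIV_imp_deriv)
    have b: "(f1 has_real_derivative g2 s) (at s)" if "s \<in> S" for s
      using has_field_derivative_transform_within_open[OF g(2) S(1) that, of f1] a' by simp
    have b': "f2 s = g2 s" if "s \<in> S" for s
      unfolding f2_def using b[OF that] by (rule DERIV_imp_deriv)
    have "continuous_on S g2" using g(3) continuous_on_subset by blast
    hence "continuous_on S f2" using b' by (simp cong: continuous_on_cong)
    thus ?thesis using S a a' b b' by (intro exI[of _ S]) simp
  qed
  show ?thesis
  proof (rule C2I[of _ f1 f2])
    show "continuous_on UNIV f2"
      using loc by (metis continuous_at_imp_continuous_on continuous_on_eq_continuous_at)
  qed (use loc in blast)+
qed

lemma smooth_real_derivs:
  assumes "smooth (\<eta> :: real \<Rightarrow> real)"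
  shows "\<exists>D. D 0 = \<eta> \<and> (\<forall>n t. (D n has_real_derivative D (Suc n) t) (at t))"
proof (intro exI conjI allI)
  let ?D = "\<lambda>n. iter_pderiv (replicate n 1) \<eta>"
  show "?D 0 = \<eta>" by simp
  show "(?D n has_real_derivative ?D (Suc n) t) (at t)" for n t
  proof -
    have "replicate n 1 \<in> lists (Basis :: real set)" by auto
    hence "?D n differentiable (at t)" using assms unfolding smooth_def by blast
    hence "(?D n has_derivative frechet_derivative (?D n) (at t)) (at t)"
      by (simp add: frechet_derivative_works)
    moreover from this have "frechet_derivative (?D n) (at t) = (*) (frechet_derivative (?D n) (at t) 1)"
      using linear_cmul[OF has_derivative_linear, of "?D n" _ _ _ 1] by (auto simp: fun_eq_iff mult.commute)
    ultimately show ?thesis unfolding has_field_derivative_def by simp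
  qed
qed

lemma smooth_C2: assumes "smooth (\<eta> :: real \<Rightarrow> real)" shows "C2 \<eta>"
proof -
  obtain D where D: "D 0 = \<eta>" "\<And>n t. (D n has_real_derivative D (Suc n) t) (at t)"
    using smooth_real_derivs[OF assms] by blast
  show ?thesis
    using D(2)[of 0] D(2)[of 1] D(2)[of 2] D(1)
    by (intro C2I[of _ "D 1" "D 2"])
      (auto simp: numeral_2_eq_2 intro!: continuous_at_imp_continuous_on DERIV_isCont)
qed

text \<open>The denominator of \<open>psi\<close> in dimension one. The window contains every
  integer at distance less than 1 from t, hence every nonzero term, so this is the sum over all
  integers.\<close>

definition per :: "(real \<Rightarrow> real) \<Rightarrow> real \<Rightarrow> real" where
  "per \<eta> t = (\<Sum>i\<in>{\<lfloor>t\<rfloor>-1..\<lfloor>t\<rfloor>+2}. \<eta> (2 * (t - of_int i)))"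

text \<open>The one-dimensional \<open>psi\<close> at frequency 0, of which all \<open>psi\<close>
  are tensor products of translates.\<close>

definition rho :: "(real \<Rightarrow> real) \<Rightarrow> real \<Rightarrow> real" where
  "rho \<eta> t = \<eta> (2 * t) / per \<eta> t"

context
  fixes \<eta> :: "real \<Rightarrow> real"
  assumes bump: "bump \<eta>"
begin

lemma bump_zero: "\<bar>t\<bar> \<ge> 1 \<Longrightarrow> \<eta> (2 * t) = 0"
  using bump unfolding bump_def by auto

lemma bump_nonneg: "0 \<le> \<eta> t" and bump_one: "\<bar>t\<bar> \<le> 1 \<Longrightarrow> \<eta> t = 1"
  using bump unfolding bump_def by auto

lemma bump_C2: "C2 \<eta>" using bump smooth_C2 unfolding bump_def by blast

text \<open>Both sums reduce to the intersection of the two ranges. The freedom in \<open>S\<close>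
  lets one range serve a whole neighbourhood of a point.\<close>

lemma per_eq:
  assumes "finite S" "\<And>i. \<bar>t - of_int i\<bar> < 1 \<Longrightarrow> i \<in> S"
  shows "per \<eta> t = (\<Sum>i\<in>S. \<eta> (2 * (t - of_int i)))"
proof -
  let ?A = "{\<lfloor>t\<rfloor>-1..\<lfloor>t\<rfloor>+2}"
  have sub: "i \<in> ?A" if "\<bar>t - of_int i\<bar> < 1" for i :: int using that by simp linarith
  have "per \<eta> t = (\<Sum>i\<in>?A \<inter> S. \<eta> (2 * (t - of_int i)))" unfolding per_def
    by (intro sum.mono_neutral_right) (use assms(2) bump_zero in \<open>force simp: not_less[symmetric]\<close>)+
  also have "\<dots> = (\<Sum>i\<in>S. \<eta> (2 * (t - of_int i)))"
    by (intro sum.mono_neutral_left) (use assms(1) sub bump_zero in \<open>force simp: not_less[symmetric]\<close>)+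
  finally show ?thesis .
qed

text \<open>The nearest integer is at distance at most 1/2, so its term is \<eta> at a point of
  [-1, 1], that is, 1.\<close>

lemma per_ge_1: "1 \<le> per \<eta> t"
proof -
  let ?i = "round t"
  have 1: "\<bar>t - of_int ?i\<bar> \<le> 1 / 2" using of_int_round_abs_le[of t] by (simp add: abs_minus_commute)
  have "1 = (\<Sum>i\<in>{?i}. \<eta> (2 * (t - of_int i)))"
    using 1 bump_one[of "2 * (t - of_int ?i)"] by (auto simp: abs_if split: if_splits)
  also have "\<dots> \<le> per \<eta> t" unfolding per_def
  proof (rule sum_mono2)
    have "t - 1 / 2 \<le> of_int ?i" "of_int ?i \<le> t + 1 / 2" using 1 by linarith+
    thus "{?i} \<subseteq> {\<lfloor>t\<rfloor>-1..\<lfloor>t\<rfloor>+2}" by simp linarith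
  qed (simp_all add: bump_nonneg)
  finally show ?thesis .
qed

lemma per_pos: "0 < per \<eta> t" using per_ge_1[of t] by linarith

lemma per_int: "per \<eta> (t - of_int k) = per \<eta> t"
proof -
  have "per \<eta> t = (\<Sum>i\<in>{\<lfloor>t\<rfloor>-1..\<lfloor>t\<rfloor>+2}. \<eta> (2 * (t - of_int i)))" by (simp add: per_def)
  also have "\<dots> = per \<eta> (t - of_int k)" unfolding per_def
    by (rule sum.reindex_bij_witness[of _ "\<lambda>i. i + k" "\<lambda>i. i - k"]) (auto simp: algebra_simps)
  finally show ?thesis ..
qed

lemma per_C2: "C2 (per \<eta>)"
proof (rule C2_local)
  fix t :: real
  \<comment> \<open>An integer contributing at some s within 1 of t lies within 2 of t, so this
    fixed range works for all such s.\<close>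
  let ?A = "{\<lfloor>t\<rfloor>-3..\<lfloor>t\<rfloor>+4}"
  let ?g = "\<lambda>s. \<Sum>i\<in>?A. \<eta> (2 * s + (- 2 * of_int i))"
  have "C2 ?g" by (intro C2_sum C2_affine bump_C2)
  moreover have "per \<eta> s = ?g s" if "s \<in> {t-1<..<t+1}" for s
  proof -
    have "per \<eta> s = (\<Sum>i\<in>?A. \<eta> (2 * (s - of_int i)))"
    proof (rule per_eq)
      fix i :: int
      assume "\<bar>s - of_int i\<bar> < 1"
      hence "t - 2 < of_int i" "of_int i < t + 2" using that by auto
      thus "i \<in> ?A" by simp linarith
    qed simp
    thus ?thesis by (simp add: algebra_simps)
  qed
  ultimately show "\<exists>g S. C2 g \<and> open S \<and> t \<in> S \<and> (\<forall>s\<in>S. per \<eta> s = g s)"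
    by (intro exI[of _ ?g] exI[of _ "{t-1<..<t+1}"]) auto
qed

lemma rho_C2: "C2 (rho \<eta>)"
  unfolding rho_def[abs_def] using C2_affine[OF bump_C2, of 2 0]
  by (intro C2_divide per_C2) (simp_all add: per_pos less_imp_neq[symmetric])

lemma rho_zero: "\<bar>t\<bar> \<ge> 1 \<Longrightarrow> rho \<eta> t = 0" by (simp add: rho_def bump_zero)

lemma rho_nonneg: "0 \<le> rho \<eta> t"
  by (simp add: rho_def bump_nonneg per_pos less_imp_le)

lemma rho_0: "0 < rho \<eta> 0"
  by (simp add: rho_def bump_one per_pos)

end


section \<open>Decay of inverse Fourier transforms\<close>

lemma borel_measurable_cis [measurable]:
  "(\<lambda>x. cis (f x)) \<in> borel_measurable M" if "f \<in> borel_measurable M"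
  using that unfolding cis_conv_exp by measurable

lemma integrable_cis_mult:
  fixes g :: "'a::euclidean_space \<Rightarrow> complex"
  assumes "integrable lborel g" "f \<in> borel_measurable borel"
  shows "integrable lborel (\<lambda>x. cis (f x) * g x)"
  using assms by (subst integrable_norm_iff[symmetric]) (auto simp: norm_mult)

text \<open>The pointwise identity behind the bound: \<open>x\<^sup>2 e\<^bsup>ix\<xi>\<^esup> h + e\<^bsup>ix\<xi>\<^esup> h''\<close> is the \<open>\<xi>\<close>-derivative
  of \<open>e\<^bsup>ix\<xi>\<^esup> (h' - i x h)\<close>.\<close>

lemma inv_fourier_C2_decay:
  fixes h :: "real \<Rightarrow> real"
  assumes "C2 h" and supp: "\<And>t. \<bar>t\<bar> \<ge> R \<Longrightarrow> h t = 0"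
  shows "\<exists>K\<ge>0. \<forall>x. cmod (inv_fourier (\<lambda>\<xi>. complex_of_real (h \<xi>)) x) \<le> K / (1 + x\<^sup>2)"
proof -
  obtain h1 h2 where h: "\<And>t. (h has_real_derivative h1 t) (at t)"
      "\<And>t. (h1 has_real_derivative h2 t) (at t)" "continuous_on UNIV h2"
    using assms(1) unfolding C2_def by blast
  \<comment> \<open>Strictly beyond the support bound: h' is only known to vanish where h is zero on
    a neighbourhood, and both h and h' must vanish at -r and r to kill the boundary terms.\<close>
  define r where "r = \<bar>R\<bar> + 1"
  have r: "r > 0" "\<bar>R\<bar> < r" by (auto simp: r_def)
  have c: "continuous_on A h" "continuous_on A h1" "continuous_on A h2" for A
    using h by (meson DERIV_isCont continuous_at_imp_continuous_on continuous_on_subset subset_UNIV)+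
  have h1z: "h1 t = 0" if "\<bar>t\<bar> > \<bar>R\<bar>" for t
  proof (rule DERIV_unique[OF h(1)])
    have "open {t. \<bar>t\<bar> > \<bar>R\<bar>}" by (intro open_Collect_less continuous_intros)
    from has_field_derivative_transform_within_open[OF DERIV_const this]
    show "(h has_real_derivative 0) (at t)" using that supp by force
  qed
  let ?I = "\<lambda>g x. LINT \<xi>|lborel. indicator {-r..r} \<xi> *\<^sub>R (cis (x * \<xi>) * complex_of_real (g \<xi>))"
  have int: "set_integrable lborel {-r..r} (\<lambda>\<xi>. cis (x * \<xi>) * complex_of_real (g \<xi>))"
    if "continuous_on UNIV g" for g x
    by (rule borel_integrable_atLeastAtMost') (auto intro!: continuous_intros continuous_on_subset[OF that])
  have bnd: "cmod (?I g x) \<le> (LINT \<xi>|lborel. indicator {-r..r} \<xi> * \<bar>g \<xi>\<bar>)" if "continuous_on UNIV g" for g x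
  proof -
    have "cmod (?I g x) \<le> (LINT \<xi>|lborel. cmod (indicator {-r..r} \<xi> *\<^sub>R (cis (x * \<xi>) * complex_of_real (g \<xi>))))"
      by (rule integral_norm_bound)
    also have "\<dots> = (LINT \<xi>|lborel. indicator {-r..r} \<xi> * \<bar>g \<xi>\<bar>)"
      by (intro Bochner_Integration.integral_cong refl) (auto simp: norm_mult indicator_def)
    finally show ?thesis .
  qed
  have eq: "of_real (x\<^sup>2) * ?I h x = - ?I h2 x" for x
  proof -
    let ?G = "\<lambda>\<xi>. cis (x * \<xi>) * (complex_of_real (h1 \<xi>) - \<i> * of_real x * of_real (h \<xi>))"
    let ?g = "\<lambda>\<xi>. cis (x * \<xi>) * complex_of_real (h2 \<xi> + x\<^sup>2 * h \<xi>)"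
    have "(LINT \<xi>|lborel. indicator {-r..r} \<xi> *\<^sub>R ?g \<xi>) = ?G r - ?G (-r)"
    proof (rule integral_FTC_Icc)
      show "-r \<le> r" using r by simp
      show "continuous_on {-r..r} ?g" by (intro continuous_intros c)
      fix \<xi>
      have 1: "((\<lambda>\<xi>. cis (x * \<xi>)) has_vector_derivative \<i> * of_real x * cis (x * \<xi>)) (at \<xi> within {-r..r})"
        unfolding cis_conv_exp
        by (rule has_vector_derivative_real_field | rule derivative_eq_intros refl | simp)+
      show "(?G has_vector_derivative ?g \<xi>) (at \<xi> within {-r..r})"
        by (rule has_vector_derivative_eq_rhs,
            rule has_vector_derivative_mult[OF 1 has_vector_derivative_diff[OF
             has_vector_derivative_of_real[OF has_field_derivative_at_within[OF h(2)]]
             has_vector_derivative_mult_right[OF has_vector_derivative_of_real[OF has_field_derivative_at_within[OF h(1)]]]]])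
          (simp add: algebra_simps power2_eq_square)
    qed
    also have "\<dots> = 0" using r by (simp add: supp h1z)
    also have "(LINT \<xi>|lborel. indicator {-r..r} \<xi> *\<^sub>R ?g \<xi>) = ?I h2 x + of_real (x\<^sup>2) * ?I h x"
    proof -
      note i = int[OF c(3)[of UNIV], of x, unfolded set_integrable_def]
        int[OF c(1)[of UNIV], of x, unfolded set_integrable_def]
      have "(LINT \<xi>|lborel. indicator {-r..r} \<xi> *\<^sub>R ?g \<xi>) =
          (LINT \<xi>|lborel. indicator {-r..r} \<xi> *\<^sub>R (cis (x * \<xi>) * complex_of_real (h2 \<xi>)) +
            of_real (x\<^sup>2) * (indicator {-r..r} \<xi> *\<^sub>R (cis (x * \<xi>) * complex_of_real (h \<xi>))))"
        by (intro Bochner_Integration.integral_cong refl) (simp add: algebra_simps)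
      also have "\<dots> = ?I h2 x + of_real (x\<^sup>2) * ?I h x"
        by (simp only: Bochner_Integration.integral_add[OF i(1) integrable_mult_right[OF i(2)]]
            integral_mult_right_zero)
      finally show ?thesis .
    qed
    finally show ?thesis by (simp add: eq_neg_iff_add_eq_0 add.commute)
  qed
  have full: "(LINT \<xi>|lborel. cis (x * \<xi>) * complex_of_real (h \<xi>)) = ?I h x" for x
    by (rule Bochner_Integration.integral_cong) (use supp r in \<open>auto simp: indicator_def\<close>)
  define K where "K = (LINT \<xi>|lborel. indicator {-r..r} \<xi> * \<bar>h \<xi>\<bar>) + (LINT \<xi>|lborel. indicator {-r..r} \<xi> * \<bar>h2 \<xi>\<bar>)"
  have K0: "K \<ge> 0" unfolding K_def by (intro add_nonneg_nonneg Bochner_Integration.integral_nonneg) auto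
  have "cmod (inv_fourier (\<lambda>\<xi>. complex_of_real (h \<xi>)) x) \<le> (K / (2 * pi)) / (1 + x\<^sup>2)" for x
  proof -
    have "x\<^sup>2 * cmod (?I h x) = cmod (of_real (x\<^sup>2) * ?I h x)" by (simp add: norm_mult norm_power)
    also have "\<dots> = cmod (?I h2 x)" unfolding eq by simp
    finally have "(1 + x\<^sup>2) * cmod (?I h x) \<le> K"
      using bnd[OF c(1)[of UNIV], of x] bnd[OF c(3)[of UNIV], of x] by (simp add: K_def algebra_simps)
    hence "cmod (?I h x) \<le> K / (1 + x\<^sup>2)"
      by (subst pos_le_divide_eq) (auto simp: add_pos_nonneg mult.commute)
    hence "cmod (?I h x) / (2 * pi) \<le> K / (1 + x\<^sup>2) / (2 * pi)" by (intro divide_right_mono) auto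
    thus ?thesis unfolding inv_fourier_def
      by (simp add: full norm_mult norm_divide) (simp add: field_simps)
  qed
  thus ?thesis using K0 by (intro exI[of _ "K / (2 * pi)"]) auto
qed

lemma integrable_inverse_square: "integrable lborel (\<lambda>x::real. 1 / (1 + x\<^sup>2))"
  using integrable_inverse_1_plus_square by (simp add: set_integrable_def einterval_def inverse_eq_divide)


section \<open>Product structure and Fourier inversion on the line\<close>

text \<open>The majorant |g x| |h y| makes the integrand absolutely integrable on the product. With
  a Fourier kernel for \<open>K\<close>, this is the rule that moves a transform from one factor to
  the other.\<close>

lemma fubini_bounded_kernel:
  fixes g h :: "'a::euclidean_space \<Rightarrow> complex"
  assumes g: "integrable lborel g" and h: "integrable lborel h"
    and K[measurable]: "case_prod K \<in> borel_measurable (lborel \<Otimes>\<^sub>M lborel)" and K1: "\<And>x y. cmod (K x y) \<le> 1"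
  shows "(LINT x|lborel. g x * (LINT y|lborel. K x y * h y)) = (LINT y|lborel. h y * (LINT x|lborel. K x y * g x))"
proof -
  have [measurable]: "g \<in> borel_measurable borel" "h \<in> borel_measurable borel" using g h by auto
  have [measurable]: "K x \<in> borel_measurable lborel" for x
    using measurable_compose[OF measurable_Pair1' K, of x] by simp
  have hK: "integrable lborel (\<lambda>y. K x y * h y)" for x
    by (rule Bochner_Integration.integrable_bound[OF h])
      (auto simp: norm_mult intro!: mult_left_le_one_le K1)
  have "integrable (lborel \<Otimes>\<^sub>M lborel) (\<lambda>(x, y). g x * (K x y * h y))"
  proof (rule lborel_pair.Fubini_integrable)
    show "(\<lambda>(x, y). g x * (K x y * h y)) \<in> borel_measurable (lborel \<Otimes>\<^sub>M lborel)"
      by (simp add: split_beta') measurable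
    have "integrable lborel (\<lambda>x. cmod (g x) * (LINT y|lborel. cmod (K x y * h y)))"
    proof (rule Bochner_Integration.integrable_bound)
      show "integrable lborel (\<lambda>x. (LINT y|lborel. cmod (h y)) * g x)" using g by simp
      show "AE x in lborel. norm (cmod (g x) * (LINT y|lborel. cmod (K x y * h y))) \<le> norm ((LINT y|lborel. cmod (h y)) * g x)"
      proof (rule AE_I2)
        fix x
        have "(LINT y|lborel. cmod (K x y * h y)) \<le> (LINT y|lborel. cmod (h y))"
          by (rule integral_mono[OF integrable_norm[OF hK] integrable_norm[OF h]])
            (auto simp: norm_mult intro!: mult_left_le_one_le K1)
        thus "norm (cmod (g x) * (LINT y|lborel. cmod (K x y * h y))) \<le> norm ((LINT y|lborel. cmod (h y)) * g x)"
          by (simp add: norm_mult mult.commute mult_left_mono)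
      qed
    qed measurable
    thus "integrable lborel (\<lambda>x. LINT y|lborel. cmod (case (x, y) of (x, y) \<Rightarrow> g x * (K x y * h y)))"
      by (simp add: norm_mult)
  qed (use hK in simp)
  from lborel_pair.Fubini_integral[OF this]
  have "(LINT x|lborel. LINT y|lborel. g x * (K x y * h y)) = (LINT y|lborel. LINT x|lborel. g x * (K x y * h y))"
    by simp
  also have "\<dots> = (LINT y|lborel. LINT x|lborel. h y * (K x y * g x))"
    by (simp add: mult_ac)
  finally show ?thesis by simp
qed

text \<open>Lebesgue measure is the image of the product of one-dimensional Lebesgue measures over
  the basis, so tensor products integrate factor by factor.\<close>

lemma
  fixes f :: "'a::euclidean_space \<Rightarrow> real \<Rightarrow> 'b::{real_normed_field, banach, second_countable_topology}"
  assumes "\<And>b. b \<in> Basis \<Longrightarrow> integrable lborel (f b)"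
  shows integrable_lborel_prod: "integrable lborel (\<lambda>x::'a. \<Prod>b\<in>Basis. f b (x \<bullet> b))"
    and integral_lborel_prod: "(LINT x|lborel. (\<Prod>b\<in>Basis. f b ((x::'a) \<bullet> b))) = (\<Prod>b\<in>Basis. (LINT t|lborel. f b t))"
proof -
  interpret product_sigma_finite "\<lambda>b::'a. lborel :: real measure" ..
  have [measurable]: "b \<in> Basis \<Longrightarrow> f b \<in> borel_measurable borel" for b using assms by auto
  have eq: "(\<Prod>b\<in>Basis. f b ((\<Sum>c\<in>Basis. g c *\<^sub>R c) \<bullet> b)) = (\<Prod>b\<in>Basis. f b (g b))" for g
    by (intro prod.cong refl) simp
  have m: "(\<lambda>x::'a. \<Prod>b\<in>Basis. f b (x \<bullet> b)) \<in> borel_measurable borel" by measurable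
  show "integrable lborel (\<lambda>x::'a. \<Prod>b\<in>Basis. f b (x \<bullet> b))"
    unfolding lborel_eq[where 'a='a]
    by (subst integrable_distr_eq[OF _ m]) (auto simp: eq intro!: product_integrable_prod assms)
  show "(LINT x|lborel. (\<Prod>b\<in>Basis. f b ((x::'a) \<bullet> b))) = (\<Prod>b\<in>Basis. (LINT t|lborel. f b t))"
    unfolding lborel_eq[where 'a='a]
    by (subst integral_distr[OF _ m]) (auto simp: eq intro!: product_integral_prod assms)
qed

section \<open>Fourier transforms of tensor products, and Gaussians\<close>

lemma cis_sum: "cis (\<Sum>i\<in>I. f i) = (\<Prod>i\<in>I. cis (f i))"
  by (induction I rule: infinite_finite_induct) (auto simp: cis_mult[symmetric])

lemma fourier_prod:
  fixes f :: "'a::euclidean_space \<Rightarrow> real \<Rightarrow> complex"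
  assumes "\<And>b. b \<in> Basis \<Longrightarrow> integrable lborel (f b)"
  shows "fourier (\<lambda>x::'a. \<Prod>b\<in>Basis. f b (x \<bullet> b)) \<xi> = (\<Prod>b\<in>Basis. fourier (f b) (\<xi> \<bullet> b))"
proof -
  have "fourier (\<lambda>x::'a. \<Prod>b\<in>Basis. f b (x \<bullet> b)) \<xi> =
      (LINT x|lborel. (\<Prod>b\<in>Basis. cis (- ((x \<bullet> b) * (\<xi> \<bullet> b))) * f b (x \<bullet> b)))"
    unfolding fourier_def
    by (subst euclidean_inner) (simp add: sum_negf[symmetric] cis_sum prod.distrib)
  also have "\<dots> = (\<Prod>b\<in>Basis. (LINT t|lborel. cis (- (t * (\<xi> \<bullet> b))) * f b t))"
    by (rule integral_lborel_prod) (auto intro!: integrable_cis_mult assms)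
  finally show ?thesis by (simp add: fourier_def)
qed

lemma inv_fourier_prod:
  fixes f :: "'a::euclidean_space \<Rightarrow> real \<Rightarrow> complex"
  assumes "\<And>b. b \<in> Basis \<Longrightarrow> integrable lborel (f b)"
  shows "inv_fourier (\<lambda>x::'a. \<Prod>b\<in>Basis. f b (x \<bullet> b)) \<xi> = (\<Prod>b\<in>Basis. inv_fourier (f b) (\<xi> \<bullet> b))"
proof -
  have "(LINT x|lborel. cis (\<xi> \<bullet> x) * (\<Prod>b\<in>Basis. f b (x \<bullet> b))) =
      (LINT x|lborel. (\<Prod>b\<in>Basis. cis ((\<xi> \<bullet> b) * (x \<bullet> b)) * f b (x \<bullet> b)))"
    by (subst euclidean_inner) (simp add: cis_sum prod.distrib)
  also have "\<dots> = (\<Prod>b\<in>Basis. (LINT t|lborel. cis ((\<xi> \<bullet> b) * t) * f b t))"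
    by (rule integral_lborel_prod) (auto intro!: integrable_cis_mult assms)
  finally show ?thesis by (simp add: inv_fourier_def prod_dividef power_mult_distrib)
qed

text \<open>The characteristic function of the standard normal law at u / \<sigma>, after the
  substitution of \<sigma> x for x.\<close>

lemma gaussian_fourier:
  fixes \<sigma> u :: real
  assumes "\<sigma> > 0"
  shows "(LINT x|lborel. cis (x * u) * of_real (exp (- (\<sigma> * x)\<^sup>2 / 2))) =
    of_real (sqrt (2 * pi) / \<sigma> * exp (- (u / \<sigma>)\<^sup>2 / 2))"
proof -
  have "of_real (exp (- (u / \<sigma>)\<^sup>2 / 2)) = char std_normal_distribution (u / \<sigma>)"
    by (simp add: char_std_normal_distribution)
  also have "\<dots> = (LINT x|lborel. std_normal_density x *\<^sub>R cis (u / \<sigma> * x))"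
    unfolding char_def by (subst integral_density) (auto simp: cis_conv_exp normal_density_nonneg)
  also have "\<dots> = \<sigma> *\<^sub>R (LINT x|lborel. std_normal_density (0 + \<sigma> * x) *\<^sub>R cis (u / \<sigma> * (0 + \<sigma> * x)))"
    using assms by (subst lborel_integral_real_affine[of \<sigma> _ 0]) auto
  also have "(LINT x|lborel. std_normal_density (0 + \<sigma> * x) *\<^sub>R cis (u / \<sigma> * (0 + \<sigma> * x))) =
     (LINT x|lborel. of_real (1 / sqrt (2 * pi)) * (cis (x * u) * of_real (exp (- (\<sigma> * x)\<^sup>2 / 2))))"
    using assms
    by (intro Bochner_Integration.integral_cong refl) (simp add: std_normal_density_def scaleR_conv_of_real mult_ac)
  finally show ?thesis using assms
    by (simp add: scaleR_conv_of_real field_simps)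
qed

lemma gaussian_integrable:
  fixes \<sigma> :: real
  assumes "\<sigma> > 0"
  shows "integrable lborel (\<lambda>x. exp (- (\<sigma> * x)\<^sup>2 / 2))"
proof -
  have "integrable lborel (\<lambda>x. sqrt (2 * pi) * std_normal_density (0 + \<sigma> * x))"
    using assms by (intro integrable_mult_right lborel_integrable_real_affine) auto
  thus ?thesis by (simp add: std_normal_density_def)
qed

text \<open>Gaussian summation: with the weight \<open>exp (- (\<sigma> x)\<^sup>2 / 2)\<close> inserted, the Fourier integral of
  \<open>inv_fourier h\<close> is an average of \<open>h\<close> around \<open>\<xi>\<close> at scale \<open>\<sigma>\<close>.\<close>

lemma fourier_inv_fourier:
  fixes h :: "real \<Rightarrow> complex"
  assumes h: "continuous_on UNIV h" "integrable lborel h" and B: "\<And>t. cmod (h t) \<le> B"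
    and v: "integrable lborel (inv_fourier h)"
  shows "fourier (inv_fourier h) \<xi> = h \<xi>"
proof -
  have [measurable]: "h \<in> borel_measurable borel" "inv_fourier h \<in> borel_measurable borel" using h v by auto
  let ?g = "\<lambda>\<sigma> x::real. exp (- (\<sigma> * x)\<^sup>2 / 2)"
  let ?A = "\<lambda>\<sigma>. LINT x|lborel. (cis (- (x * \<xi>)) * inv_fourier h x) * of_real (?g \<sigma> x)"
  have A: "?A \<sigma> = (LINT z|lborel. h (\<xi> + \<sigma> * z) * of_real (std_normal_density z))" if "\<sigma> > 0" for \<sigma>
  proof -
    have "?A \<sigma> = of_real (1 / (2 * pi)) * (LINT x|lborel. of_real (?g \<sigma> x) * (LINT \<zeta>|lborel. cis (x * (\<zeta> - \<xi>)) * h \<zeta>))"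
    proof -
      have "(cis (- (x * \<xi>)) * inv_fourier h x) * of_real (?g \<sigma> x) =
          of_real (1 / (2 * pi)) * (of_real (?g \<sigma> x) * (LINT \<zeta>|lborel. cis (x * (\<zeta> - \<xi>)) * h \<zeta>))" for x
      proof -
        have "cis (x * (\<zeta> - \<xi>)) * h \<zeta> = cis (- (x * \<xi>)) * (cis (x * \<zeta>) * h \<zeta>)" for \<zeta>
          unfolding mult.assoc[symmetric] cis_mult by (simp add: right_diff_distrib)
        hence "(LINT \<zeta>|lborel. cis (x * (\<zeta> - \<xi>)) * h \<zeta>) = cis (- (x * \<xi>)) * (LINT \<zeta>|lborel. cis (x * \<zeta>) * h \<zeta>)"
          by (simp only: integral_mult_right_zero)
        thus ?thesis by (simp add: inv_fourier_def)
      qed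
      thus ?thesis by (simp only: integral_mult_right_zero)
    qed
    also have "(LINT x|lborel. of_real (?g \<sigma> x) * (LINT \<zeta>|lborel. cis (x * (\<zeta> - \<xi>)) * h \<zeta>)) =
       (LINT \<zeta>|lborel. h \<zeta> * (LINT x|lborel. cis (x * (\<zeta> - \<xi>)) * of_real (?g \<sigma> x)))"
      using h(2) gaussian_integrable[OF that]
      by (intro fubini_bounded_kernel) (auto simp: split_beta')
    also have "\<dots> = (LINT \<zeta>|lborel. h \<zeta> * of_real (sqrt (2 * pi) / \<sigma> * exp (- ((\<zeta> - \<xi>) / \<sigma>)\<^sup>2 / 2)))"
      using gaussian_fourier[OF that] by simp
    also have "\<dots> = \<sigma> *\<^sub>R (LINT z|lborel. h (\<xi> + \<sigma> * z) * of_real (sqrt (2 * pi) / \<sigma> * exp (- ((\<xi> + \<sigma> * z - \<xi>) / \<sigma>)\<^sup>2 / 2)))"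
      using that by (subst lborel_integral_real_affine[of \<sigma> _ \<xi>]) auto
    also have "(LINT z|lborel. h (\<xi> + \<sigma> * z) * of_real (sqrt (2 * pi) / \<sigma> * exp (- ((\<xi> + \<sigma> * z - \<xi>) / \<sigma>)\<^sup>2 / 2))) =
       (LINT z|lborel. of_real (2 * pi / \<sigma>) * (h (\<xi> + \<sigma> * z) * of_real (std_normal_density z)))"
      using that by (intro Bochner_Integration.integral_cong refl)
        (simp add: std_normal_density_def field_simps flip: of_real_mult)
    finally show ?thesis using that by (simp add: scaleR_conv_of_real)
  qed
  \<comment> \<open>Along these scales both forms of \<open>?A\<close> converge. The weight tends to
    1, with \<open>inv_fourier h\<close> as integrable majorant; the average concentrates at \<xi>,
    with \<open>B\<close> times the normal density as majorant.\<close>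
  define s where "s n = inverse (real (Suc n))" for n
  have s: "s n > 0" for n by (simp add: s_def)
  have s0: "s \<longlonglongrightarrow> 0" unfolding s_def by (rule LIMSEQ_inverse_real_of_nat)
  have "(\<lambda>n. ?A (s n)) \<longlonglongrightarrow> (LINT x|lborel. (cis (- (x * \<xi>)) * inv_fourier h x) * of_real (?g 0 x))"
  proof (rule integral_dominated_convergence[where w="\<lambda>x. cmod (inv_fourier h x)"])
    show "AE x in lborel. (\<lambda>n. (cis (- (x * \<xi>)) * inv_fourier h x) * of_real (?g (s n) x))
        \<longlonglongrightarrow> (cis (- (x * \<xi>)) * inv_fourier h x) * of_real (?g 0 x)"
      by (intro AE_I2 tendsto_intros s0) auto
    show "AE x in lborel. cmod ((cis (- (x * \<xi>)) * inv_fourier h x) * of_real (?g (s n) x)) \<le> cmod (inv_fourier h x)" for n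
      by (intro AE_I2) (simp add: norm_mult mult_left_le)
  qed (use v in auto)
  hence 1: "(\<lambda>n. ?A (s n)) \<longlonglongrightarrow> fourier (inv_fourier h) \<xi>" by (simp add: fourier_def)
  have "(\<lambda>n. LINT z|lborel. h (\<xi> + s n * z) * of_real (std_normal_density z)) \<longlonglongrightarrow>
      (LINT z|lborel. h (\<xi> + 0 * z) * of_real (std_normal_density z))"
  proof (rule integral_dominated_convergence[where w="\<lambda>z. B * std_normal_density z"])
    show "AE z in lborel. (\<lambda>n. h (\<xi> + s n * z) * of_real (std_normal_density z)) \<longlonglongrightarrow>
        h (\<xi> + 0 * z) * of_real (std_normal_density z)"
      using h(1) by (intro AE_I2 tendsto_intros s0 continuous_on_tendsto_compose[OF h(1)]) auto
    show "AE z in lborel. cmod (h (\<xi> + s n * z) * of_real (std_normal_density z)) \<le> B * std_normal_density z" for n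
      by (intro AE_I2) (simp add: norm_mult normal_density_nonneg mult_right_mono B)
  qed auto
  also have "(LINT z|lborel. h (\<xi> + 0 * z) * of_real (std_normal_density z)) = h \<xi>"
    by (simp add: integral_complex_of_real integral_normal_density)
  finally have "(\<lambda>n. ?A (s n)) \<longlonglongrightarrow> h \<xi>" by (simp only: A[OF s])
  with 1 show ?thesis by (rule LIMSEQ_unique)
qed


section \<open>Test functions\<close>

lemma schwartz_continuous: "schwartz \<phi> \<Longrightarrow> continuous_on UNIV \<phi>"
  unfolding schwartz_def smooth_def
  by (metis iter_pderiv.simps(1) lists.Nil continuous_at_imp_continuous_on differentiable_imp_continuous_within)

lemma schwartz_bound:
  fixes \<phi> :: "'a::euclidean_space \<Rightarrow> complex"
  assumes "schwartz \<phi>"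
  shows "\<exists>C. \<forall>x. japanese x ^ N * cmod (\<phi> x) \<le> C"
proof -
  have "bdd_above (range (\<lambda>x. japanese x ^ N * cmod (iter_pderiv [] \<phi> x)))"
    by (rule assms[unfolded schwartz_def, THEN conjunct2, THEN bspec, OF lists.Nil, THEN spec])
  thus ?thesis unfolding bdd_above_def by auto
qed

text \<open>At order 0 only the empty list of derivatives remains and the weight is 1, so the
  seminorm is the supremum norm. Pairing with an integrable function is continuous for it.\<close>

lemma schwartz_norm_0:
  fixes \<phi> :: "'a::euclidean_space \<Rightarrow> complex"
  assumes "schwartz \<phi>"
  shows "cmod (\<phi> x) \<le> schwartz_norm 0 \<phi>"
proof -
  have "{bs \<in> lists Basis. length bs \<le> 0} = {[] :: 'a list}" by auto
  moreover have "bdd_above (range (\<lambda>x. cmod (\<phi> x)))"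
    using schwartz_bound[OF assms, of 0] unfolding bdd_above_def by auto
  ultimately show ?thesis by (auto simp: schwartz_norm_def intro!: cSUP_upper)
qed

lemma japanese_ge_1: "1 \<le> japanese x" by (simp add: japanese_def)

lemma integrable_prod_inverse_square:
  "integrable lborel (\<lambda>x::'a::euclidean_space. \<Prod>b\<in>Basis. 1 / (1 + (x \<bullet> b)\<^sup>2))"
  by (rule integrable_lborel_prod) (rule integrable_inverse_square)

text \<open>Each 1 + x_b^2 is at most the square of \<open>japanese x\<close>. Decay of order twice
  the dimension therefore dominates the function by a tensor product of integrable
  functions.\<close>

lemma schwartz_integrable:
  fixes \<phi> :: "'a::euclidean_space \<Rightarrow> complex"
  assumes "schwartz \<phi>"
  shows "integrable lborel \<phi>"
proof -
  obtain C where C: "\<And>x. japanese x ^ (2 * DIM('a)) * cmod (\<phi> x) \<le> C"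
    using schwartz_bound[OF assms] by blast
  have "cmod (\<phi> x) \<le> C * (\<Prod>b\<in>Basis. 1 / (1 + (x \<bullet> b)\<^sup>2))" for x
  proof -
    have "(\<Prod>b\<in>Basis. 1 + (x \<bullet> b)\<^sup>2) \<le> (\<Prod>b\<in>(Basis::'a set). 1 + (norm x)\<^sup>2)"
      by (intro prod_mono) (auto simp: Basis_le_norm add_nonneg_nonneg abs_le_square_iff[symmetric])
    also have "\<dots> = japanese x ^ (2 * DIM('a))"
      by (simp add: japanese_def power_mult)
    finally have "(\<Prod>b\<in>Basis. 1 + (x \<bullet> b)\<^sup>2) * cmod (\<phi> x) \<le> C"
      using C[of x] by (meson mult_right_mono norm_ge_zero order_trans)
    moreover have "0 < (\<Prod>b\<in>Basis. 1 + (x \<bullet> b)\<^sup>2)" by (intro prod_pos) (auto simp: add_pos_nonneg)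
    ultimately show ?thesis by (simp add: prod_dividef field_simps)
  qed
  thus ?thesis
    using schwartz_continuous[OF assms]
    by (intro Bochner_Integration.integrable_bound[OF integrable_mult_right[OF integrable_prod_inverse_square, of C]])
      (auto intro!: borel_measurable_continuous_onI AE_I2 intro: order_trans[OF _ abs_ge_self])
qed

text \<open>Supplies test functions concentrated at \<open>x0\<close>, inside a cube of half-side 2
  / a. Partial derivatives of a tensor product are tensor products again, and compact support turns
  continuity into decay.\<close>

lemma schwartz_bump_product:
  fixes x0 :: "'a::euclidean_space"
  assumes "bump \<eta>" "a > 0"
  shows "schwartz (\<lambda>x. complex_of_real (\<Prod>b\<in>Basis. \<eta> (a * (x \<bullet> b - x0 \<bullet> b))))" (is "schwartz ?\<phi>")
proof -
  obtain D where D: "D 0 = \<eta>" "\<And>n t. (D n has_real_derivative D (Suc n) t) (at t)"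
    using smooth_real_derivs assms(1) unfolding bump_def by metis
  have Dc: "continuous_on UNIV (D n)" for n
    using D(2) by (meson DERIV_isCont continuous_at_imp_continuous_on)
  have Dz: "D n t = 0" if "\<bar>t\<bar> > 2" for n t
    using that
  proof (induction n arbitrary: t)
    case 0
    thus ?case using assms(1) D(1) unfolding bump_def by simp
  next
    case (Suc n)
    have "open {t::real. \<bar>t\<bar> > 2}" by (intro open_Collect_less continuous_intros)
    from has_field_derivative_transform_within_open[OF DERIV_const[of 0] this, of t "D n"]
    have "(D n has_real_derivative 0) (at t)" using Suc by simp
    thus ?case using D(2) DERIV_unique by blast
  qed
  define f where "f n b x = a ^ n * D n (a * (x \<bullet> b - x0 \<bullet> b))" for n and b x :: 'a
  \<comment> \<open>The closed form of an iterated derivative: the factor in direction b is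
    differentiated as often as b occurs in \<open>bs\<close>. One more derivative raises exactly one
    count.\<close>
  define P where "P bs x = complex_of_real (\<Prod>b\<in>Basis. f (count_list bs b) b x)" for bs :: "'a list" and x
  have fd: "(f n b has_derivative (\<lambda>y. f (Suc n) b x * (y \<bullet> b))) (at x)" for n b x
  proof -
    have "((\<lambda>x. a * (x \<bullet> b - x0 \<bullet> b)) has_derivative (\<lambda>y. a * (y \<bullet> b))) (at x)"
      by (auto intro!: derivative_eq_intros)
    moreover have "(D n has_derivative (*) (D (Suc n) (a * (x \<bullet> b - x0 \<bullet> b)))) (at (a * (x \<bullet> b - x0 \<bullet> b)))"
      using D(2) unfolding has_field_derivative_def .
    ultimately have "((\<lambda>x. D n (a * (x \<bullet> b - x0 \<bullet> b))) has_derivative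
        (\<lambda>y. D (Suc n) (a * (x \<bullet> b - x0 \<bullet> b)) * (a * (y \<bullet> b)))) (at x)"
      using has_derivative_compose by fastforce
    from has_derivative_mult_right[OF this, of "a ^ n"] show ?thesis
      unfolding f_def by (simp add: mult_ac)
  qed
  have Pd: "(P bs has_derivative (\<lambda>y. complex_of_real (\<Sum>i\<in>Basis. f (Suc (count_list bs i)) i x * (y \<bullet> i) *
      (\<Prod>j\<in>Basis - {i}. f (count_list bs j) j x)))) (at x)" for bs x
    unfolding P_def by (intro has_derivative_of_real has_derivative_prod fd)
  have step: "frechet_derivative (P bs) (at x) c = P (c # bs) x" if "c \<in> Basis" for bs x c
  proof -
    have "frechet_derivative (P bs) (at x) c = complex_of_real (\<Sum>i\<in>Basis. f (Suc (count_list bs i)) i x * (c \<bullet> i) *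
      (\<Prod>j\<in>Basis - {i}. f (count_list bs j) j x))"
      by (simp only: frechet_derivative_at[OF Pd, symmetric])
    also have "(\<Sum>i\<in>Basis. f (Suc (count_list bs i)) i x * (c \<bullet> i) * (\<Prod>j\<in>Basis - {i}. f (count_list bs j) j x))
      = (\<Sum>i\<in>{c}. f (Suc (count_list bs i)) i x * (c \<bullet> i) * (\<Prod>j\<in>Basis - {i}. f (count_list bs j) j x))"
      using that by (intro sum.mono_neutral_right) (auto simp: inner_Basis)
    also have "\<dots> = f (count_list (c # bs) c) c x * (\<Prod>j\<in>Basis - {c}. f (count_list (c # bs) j) j x)"
    proof -
      have "(\<Prod>j\<in>Basis - {c}. f (count_list bs j) j x) = (\<Prod>j\<in>Basis - {c}. f (count_list (c # bs) j) j x)"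
        by (rule prod.cong) auto
      thus ?thesis using that by (simp add: inner_Basis)
    qed
    also have "\<dots> = (\<Prod>j\<in>Basis. f (count_list (c # bs) j) j x)"
      using prod.remove[OF finite_Basis that, of "\<lambda>j. f (count_list (c # bs) j) j x"] by simp
    finally show ?thesis unfolding P_def[of "c # bs" x] .
  qed
  have iter: "iter_pderiv bs ?\<phi> = P bs" if "bs \<in> lists Basis" for bs
    using that
  proof (induction bs)
    case Nil
    show ?case by (simp add: P_def f_def D(1) fun_eq_iff)
  next
    case (Cons c bs)
    hence "iter_pderiv bs ?\<phi> = P bs" "c \<in> Basis" by auto
    thus ?case by (simp only: iter_pderiv.simps step)
  qed
  define S where "S = cbox (x0 - (2 / a) *\<^sub>R One) (x0 + (2 / a) *\<^sub>R One)"
  have bdd: "bdd_above (range (\<lambda>x. japanese x ^ N * cmod (P bs x)))" for N bs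
  proof -
    have c: "continuous_on UNIV (\<lambda>x. japanese x ^ N * cmod (P bs x))"
      unfolding japanese_def P_def f_def
      by (intro continuous_intros continuous_on_compose2[OF Dc]) auto
    have "bdd_above ((\<lambda>x. japanese x ^ N * cmod (P bs x)) ` S)"
      unfolding S_def
      by (intro bounded_imp_bdd_above compact_imp_bounded compact_continuous_image compact_cbox
          continuous_on_subset[OF c]) auto
    then obtain B where B: "\<And>x. x \<in> S \<Longrightarrow> japanese x ^ N * cmod (P bs x) \<le> B"
      unfolding bdd_above_def by auto
    have "P bs x = 0" if xS: "x \<notin> S" for x
    proof -
      obtain b where b: "b \<in> Basis" "\<not> (x0 \<bullet> b - 2 / a \<le> x \<bullet> b \<and> x \<bullet> b \<le> x0 \<bullet> b + 2 / a)"
        using xS unfolding S_def mem_box by (auto simp: inner_simps)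
      have "2 / a < \<bar>x \<bullet> b - x0 \<bullet> b\<bar>" using b(2) by linarith
      hence "2 < a * \<bar>x \<bullet> b - x0 \<bullet> b\<bar>" using assms(2) by (simp add: pos_divide_less_eq mult.commute)
      hence "2 < \<bar>a * (x \<bullet> b - x0 \<bullet> b)\<bar>" using assms(2) by (simp add: abs_mult)
      hence "f (count_list bs b) b x = 0" by (simp add: f_def Dz)
      thus ?thesis using b(1) unfolding P_def by (auto simp: prod_zero_iff)
    qed
    hence "japanese x ^ N * cmod (P bs x) \<le> max B 0" for x
      by (cases "x \<in> S") (use B in \<open>auto simp: max.coboundedI1\<close>)
    thus ?thesis by (intro bdd_aboveI) auto
  qed
  show ?thesis
    unfolding schwartz_def smooth_def
  proof (intro conjI ballI allI)
    fix bs :: "'a list" and x N assume bs: "bs \<in> lists Basis"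
    show "iter_pderiv bs ?\<phi> differentiable (at x)"
      unfolding iter[OF bs] by (rule differentiableI[OF Pd])
    show "bdd_above (range (\<lambda>x. japanese x ^ N * cmod (iter_pderiv bs ?\<phi> x)))"
      unfolding iter[OF bs] by (rule bdd)
  qed
qed

section \<open>Uniqueness of continuous representatives\<close>

lemma continuous_nonneg_integral_0:
  fixes f :: "'a::euclidean_space \<Rightarrow> real"
  assumes "continuous_on UNIV f" "\<And>x. 0 \<le> f x" "integrable lborel f" "integral\<^sup>L lborel f = 0"
  shows "f x = 0"
proof (rule ccontr)
  assume "f x \<noteq> 0"
  have "AE x in lborel. f x = 0"
    using assms by (subst (asm) integral_nonneg_eq_0_iff_AE) auto
  hence "{x. f x \<noteq> 0} \<in> null_sets lborel"
    using assms(3) by (subst AE_iff_null_sets) (auto simp: borel_measurable_integrable)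
  hence "negligible {x. f x \<noteq> 0}"
    by (simp add: negligible_iff_null_sets null_sets_completionI)
  moreover have "open {x. f x \<noteq> 0}" by (intro open_Collect_neq assms continuous_intros)
  ultimately show False using open_not_negligible \<open>f x \<noteq> 0\<close> by blast
qed

text \<open>Makes the description in \<open>box_fun\<close> unambiguous. Multiplying by the
  conjugate of \<open>u x0\<close> gives a real part that is positive near \<open>x0\<close>; tested
  against a bump inside that neighbourhood, it is a nonnegative continuous function with integral 0
  but a positive value at \<open>x0\<close>.\<close>

lemma continuous_zero_if_pairing_zero:
  fixes u :: "'a::euclidean_space \<Rightarrow> complex"
  assumes "bump \<eta>" and u: "continuous_on UNIV u"
    and "\<And>\<phi>. schwartz \<phi> \<Longrightarrow> integrable lborel (\<lambda>x. u x * \<phi> x)" "\<And>\<phi>. schwartz \<phi> \<Longrightarrow> pairing u \<phi> = 0"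
  shows "u x0 = 0"
proof (rule ccontr)
  assume nz: "u x0 \<noteq> 0"
  define w where "w x = Re (cnj (u x0) * u x)" for x
  have wc: "continuous_on UNIV w" unfolding w_def by (intro continuous_intros u)
  have w0: "w x0 > 0"
    using nz unfolding w_def by (simp add: complex_eq_iff sum_power2_gt_zero_iff flip: power2_eq_square)
  have "open {x. w x > 0}" by (intro open_Collect_less wc continuous_intros)
  then obtain d where d: "d > 0" "ball x0 d \<subseteq> {x. w x > 0}"
    using w0 openE by (metis mem_Collect_eq)
  \<comment> \<open>The bump lives in a cube of half-side 2 / a, whose points are at distance at
    most 2 * DIM / a = d / 2 from the centre by the l^1 bound on the norm.\<close>
  define a where "a = 4 * DIM('a) / d"
  have a: "a > 0" unfolding a_def using d by simp
  define \<phi> where "\<phi> x = (\<Prod>b\<in>Basis. \<eta> (a * (x \<bullet> b - x0 \<bullet> b)))" for x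
  have sch: "schwartz (\<lambda>x. complex_of_real (\<phi> x))"
    unfolding \<phi>_def by (rule schwartz_bump_product[OF assms(1) a])
  have \<phi>0: "\<phi> x \<ge> 0" for x unfolding \<phi>_def using assms(1) by (auto intro!: prod_nonneg simp: bump_def)
  have out: "\<phi> x = 0" if "x \<notin> ball x0 d" for x
  proof (rule ccontr)
    assume "\<phi> x \<noteq> 0"
    have "\<bar>(x - x0) \<bullet> b\<bar> \<le> 2 / a" if b: "b \<in> Basis" for b
    proof -
      have "\<eta> (a * (x \<bullet> b - x0 \<bullet> b)) \<noteq> 0" using \<open>\<phi> x \<noteq> 0\<close> b unfolding \<phi>_def by (auto simp: prod_zero_iff)
      hence "\<bar>a * (x \<bullet> b - x0 \<bullet> b)\<bar> \<le> 2" using assms(1) unfolding bump_def by (meson le_cases)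
      hence "a * \<bar>(x - x0) \<bullet> b\<bar> \<le> 2" using a by (simp add: abs_mult inner_diff_left)
      thus ?thesis using a by (simp add: pos_le_divide_eq mult.commute)
    qed
    hence "norm (x - x0) \<le> (\<Sum>b\<in>(Basis::'a set). 2 / a)"
      by (intro order_trans[OF norm_le_l1] sum_mono) auto
    also have "\<dots> < d" using d by (simp add: a_def field_simps)
    finally show False using that by (simp add: dist_norm norm_minus_commute)
  qed
  have "w x0 * \<phi> x0 = 0"
  proof (rule continuous_nonneg_integral_0[where f="\<lambda>x. w x * \<phi> x"])
    have "continuous_on UNIV \<phi>"
      using continuous_on_Re[OF schwartz_continuous[OF sch]] by simp
    thus "continuous_on UNIV (\<lambda>x. w x * \<phi> x)" by (intro continuous_intros wc)
    show "0 \<le> w x * \<phi> x" for x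
      using d(2) \<phi>0[of x] out[of x] by (cases "x \<in> ball x0 d") (auto simp: subset_iff less_imp_le)
    have i: "integrable lborel (\<lambda>x. cnj (u x0) * (u x * complex_of_real (\<phi> x)))"
      by (intro integrable_mult_right assms(3) sch)
    have eq: "w x * \<phi> x = Re (cnj (u x0) * (u x * complex_of_real (\<phi> x)))" for x
      by (simp add: w_def algebra_simps)
    show "integrable lborel (\<lambda>x. w x * \<phi> x)" unfolding eq using i by (rule integrable_Re)
    have "(LINT x|lborel. w x * \<phi> x) = Re (cnj (u x0) * pairing u (\<lambda>x. complex_of_real (\<phi> x)))"
      unfolding eq pairing_def using i by (simp only: integral_Re integral_mult_right_zero)
    thus "(LINT x|lborel. w x * \<phi> x) = 0" using assms(4)[OF sch] by simp
  qed
  moreover have "\<phi> x0 = 1" using assms(1) by (simp add: \<phi>_def bump_def)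
  ultimately show False using w0 by simp
qed


section \<open>The representative of the frequency-localised distribution\<close>

lemma int_lattice_floor: "k \<in> int_lattice \<Longrightarrow> b \<in> Basis \<Longrightarrow> of_int \<lfloor>k \<bullet> b\<rfloor> = k \<bullet> b"
  unfolding int_lattice_def by (auto elim!: Ints_cases)

text \<open>The distributive law, with the choice functions in \<open>PiE\<close> read as lattice
  points. All other lattice points contribute 0, so the infinite sum is finite. The floor turns an
  integral real coordinate into an \<open>int\<close>.\<close>

lemma lattice_sum_prod:
  fixes f :: "'a::euclidean_space \<Rightarrow> int \<Rightarrow> real"
  assumes S: "\<And>b. b \<in> Basis \<Longrightarrow> finite (S b)"
    and z: "\<And>b i. b \<in> Basis \<Longrightarrow> i \<notin> S b \<Longrightarrow> f b i = 0"
  shows "(\<Sum>\<^sub>\<infinity>m\<in>int_lattice. \<Prod>b\<in>Basis. f b \<lfloor>(m::'a) \<bullet> b\<rfloor>) = (\<Prod>b\<in>Basis. \<Sum>i\<in>S b. f b i)"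
proof -
  define lat where "lat g = (\<Sum>b\<in>Basis. of_int (g b) *\<^sub>R b)" for g :: "'a \<Rightarrow> int"
  have lat: "lat g \<bullet> b = of_int (g b)" if "b \<in> Basis" for g b
    using that by (simp add: lat_def)
  let ?P = "PiE Basis S"
  have fin: "finite ?P" by (intro finite_PiE S) auto
  have "(\<Sum>\<^sub>\<infinity>m\<in>int_lattice. \<Prod>b\<in>Basis. f b \<lfloor>m \<bullet> b\<rfloor>) = (\<Sum>\<^sub>\<infinity>m\<in>lat ` ?P. \<Prod>b\<in>Basis. f b \<lfloor>m \<bullet> b\<rfloor>)"
  proof (rule infsum_cong_neutral)
    fix m assume m: "m \<in> int_lattice - lat ` ?P"
    have "\<exists>b\<in>Basis. \<lfloor>m \<bullet> b\<rfloor> \<notin> S b"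
    proof (rule ccontr)
      assume "\<not> ?thesis"
      hence "restrict (\<lambda>b. \<lfloor>m \<bullet> b\<rfloor>) Basis \<in> ?P" by auto
      moreover have "m = lat (restrict (\<lambda>b. \<lfloor>m \<bullet> b\<rfloor>) Basis)"
      proof (rule euclidean_eqI)
        fix b :: 'a assume b: "b \<in> Basis"
        show "m \<bullet> b = lat (restrict (\<lambda>b. \<lfloor>m \<bullet> b\<rfloor>) Basis) \<bullet> b"
          using int_lattice_floor[OF _ b, of m] m
          by (simp only: lat[OF b] restrict_apply b if_True Diff_iff simp_thms)
      qed
      ultimately show False using m by blast
    qed
    thus "(\<Prod>b\<in>Basis. f b \<lfloor>m \<bullet> b\<rfloor>) = 0" using z by (auto simp: prod_zero_iff)
  next
    fix m assume "m \<in> lat ` ?P - int_lattice"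
    thus "(\<Prod>b\<in>Basis. f b \<lfloor>m \<bullet> b\<rfloor>) = 0" by (auto simp: int_lattice_def lat)
  qed simp
  also have "\<dots> = (\<Sum>m\<in>lat ` ?P. \<Prod>b\<in>Basis. f b \<lfloor>m \<bullet> b\<rfloor>)"
    using fin by (intro infsum_finite) auto
  also have "\<dots> = (\<Sum>g\<in>?P. \<Prod>b\<in>Basis. f b \<lfloor>lat g \<bullet> b\<rfloor>)"
  proof (rule sum.reindex[unfolded o_def])
    show "inj_on lat ?P"
    proof (rule inj_onI)
      fix g h assume gh: "g \<in> ?P" "h \<in> ?P" "lat g = lat h"
      show "g = h"
      proof (rule PiE_ext[OF gh(1,2)])
        fix b :: 'a assume "b \<in> Basis"
        thus "g b = h b" using gh(3) lat by (metis of_int_eq_iff)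
      qed
    qed
  qed
  also have "\<dots> = (\<Sum>g\<in>?P. \<Prod>b\<in>Basis. f b (g b))"
    by (intro sum.cong prod.cong refl) (simp add: lat)
  also have "\<dots> = (\<Prod>b\<in>Basis. \<Sum>i\<in>S b. f b i)"
    by (intro prod_sum_PiE[symmetric] S) auto
  finally show ?thesis .
qed

lemma cube_bump_sum:
  fixes \<xi> :: "'a::euclidean_space"
  assumes "bump \<eta>"
  shows "(\<Sum>\<^sub>\<infinity>m\<in>int_lattice. cube_bump \<eta> m \<xi>) = (\<Prod>b\<in>Basis. per \<eta> (\<xi> \<bullet> b))"
proof -
  have "(\<Sum>\<^sub>\<infinity>m\<in>int_lattice. cube_bump \<eta> m \<xi>) =
    (\<Sum>\<^sub>\<infinity>m\<in>int_lattice. \<Prod>b\<in>Basis. (\<lambda>i. \<eta> (2 * (\<xi> \<bullet> b - of_int i))) \<lfloor>m \<bullet> b\<rfloor>)"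
    unfolding cube_bump_def by (intro infsum_cong prod.cong refl) (simp add: int_lattice_floor)
  also have "\<dots> = (\<Prod>b\<in>Basis. per \<eta> (\<xi> \<bullet> b))" unfolding per_def
  proof (rule lattice_sum_prod)
    fix b :: 'a and i assume "i \<notin> {\<lfloor>\<xi> \<bullet> b\<rfloor> - 1..\<lfloor>\<xi> \<bullet> b\<rfloor> + 2}"
    hence "\<bar>\<xi> \<bullet> b - of_int i\<bar> \<ge> 1" by simp linarith
    thus "\<eta> (2 * (\<xi> \<bullet> b - of_int i)) = 0" by (rule bump_zero[OF assms])
  qed auto
  finally show ?thesis .
qed

text \<open>The denominator does not depend on k; since \<open>per\<close> is invariant under
  integer shifts, it can be distributed over the translated factors.\<close>

lemma psi_prod:
  fixes \<xi> :: "'a::euclidean_space"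
  assumes "bump \<eta>" "k \<in> int_lattice"
  shows "psi \<eta> k \<xi> = (\<Prod>b\<in>Basis. rho \<eta> (\<xi> \<bullet> b - k \<bullet> b))"
proof -
  have "per \<eta> (\<xi> \<bullet> b - k \<bullet> b) = per \<eta> (\<xi> \<bullet> b)" if "b \<in> Basis" for b
    using per_int[OF assms(1), of "\<xi> \<bullet> b" "\<lfloor>k \<bullet> b\<rfloor>"] int_lattice_floor[OF assms(2) that] by simp
  thus ?thesis
    unfolding psi_def cube_bump_sum[OF assms(1)]
    by (simp add: cube_bump_def rho_def prod_dividef)
qed

text \<open>The partition of unity. \<open>K\<close> may be any finite set of cells containing those
  active at \<xi>, so that one set can serve all \<xi> in the spectrum of a packet.\<close>

lemma psi_sum:
  fixes \<xi> :: "'a::euclidean_space"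
  assumes "bump \<eta>" "finite K" "K \<subseteq> int_lattice" "\<And>k. k \<in> int_lattice - K \<Longrightarrow> psi \<eta> k \<xi> = 0"
  shows "(\<Sum>k\<in>K. psi \<eta> k \<xi>) = 1"
proof -
  let ?D = "\<Sum>\<^sub>\<infinity>m\<in>int_lattice. cube_bump \<eta> m \<xi>"
  have D: "?D > 0" using per_pos[OF assms(1)] by (simp add: cube_bump_sum[OF assms(1)] prod_pos)
  have "?D = (\<Sum>\<^sub>\<infinity>m\<in>K. cube_bump \<eta> m \<xi>)"
    by (rule infsum_cong_neutral) (use assms(3,4) D in \<open>auto simp: psi_def\<close>)
  also have "\<dots> = (\<Sum>m\<in>K. cube_bump \<eta> m \<xi>)" using assms(2) by simp
  finally show ?thesis using D by (simp add: psi_def sum_divide_distrib[symmetric])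
qed

section \<open>Integrability, continuity and bounds for transforms\<close>

lemma integrable_C2_compact:
  assumes "C2 h" "\<And>t. \<bar>t\<bar> \<ge> R \<Longrightarrow> h t = 0"
  shows "integrable lborel h"
proof -
  have "integrable lborel (\<lambda>t. indicator {-\<bar>R\<bar>..\<bar>R\<bar>} t *\<^sub>R h t)"
    by (rule borel_integrable_compact) (auto intro: C2_continuous assms)
  also have "(\<lambda>t. indicator {-\<bar>R\<bar>..\<bar>R\<bar>} t *\<^sub>R h t) = h"
  proof (rule ext)
    fix t show "indicator {-\<bar>R\<bar>..\<bar>R\<bar>} t *\<^sub>R h t = h t"
      using assms(2)[of t] by (cases "R \<le> \<bar>t\<bar>") (auto simp: indicator_def)
  qed
  finally show ?thesis .
qed

lemma integrable_rho_shift: "bump \<eta> \<Longrightarrow> integrable lborel (\<lambda>t. rho \<eta> (t - c))"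
  using lborel_integrable_real_affine[OF integrable_C2_compact[OF rho_C2 rho_zero], of \<eta>, where c=1 and t="-c"] by simp

lemma psi_integrable:
  fixes k :: "'a::euclidean_space"
  assumes "bump \<eta>" "k \<in> int_lattice"
  shows "integrable lborel (psi \<eta> k)"
proof -
  have "integrable lborel (\<lambda>\<xi>::'a. \<Prod>b\<in>Basis. (\<lambda>t. rho \<eta> (t - k \<bullet> b)) (\<xi> \<bullet> b))"
    by (rule integrable_lborel_prod) (rule integrable_rho_shift[OF assms(1)])
  thus ?thesis by (simp add: psi_prod[OF assms, abs_def])
qed

lemma continuous_cis_integral:
  fixes g :: "'a::euclidean_space \<Rightarrow> complex"
  assumes g: "integrable lborel g"
  shows "continuous_on UNIV (\<lambda>\<xi>. LINT x|lborel. cis (s * (x \<bullet> \<xi>)) * g x)"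
proof (intro continuous_at_imp_continuous_on ballI)
  fix \<xi> :: 'a
  have [measurable]: "g \<in> borel_measurable borel" using g by auto
  show "isCont (\<lambda>\<xi>. LINT x|lborel. cis (s * (x \<bullet> \<xi>)) * g x) \<xi>"
    unfolding continuous_at_sequentially o_def
  proof safe
    fix X assume X: "X \<longlonglongrightarrow> \<xi>"
    show "(\<lambda>n. LINT x|lborel. cis (s * (x \<bullet> X n)) * g x) \<longlonglongrightarrow> (LINT x|lborel. cis (s * (x \<bullet> \<xi>)) * g x)"
      by (rule integral_dominated_convergence[where w="\<lambda>x. cmod (g x)"])
        (use g in \<open>auto simp: norm_mult cis_conv_exp intro!: AE_I2 tendsto_intros X\<close>)
  qed
qed

lemma cis_integral_bound:
  fixes g :: "'a::euclidean_space \<Rightarrow> complex"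
  shows "cmod (LINT x|lborel. cis (f x) * g x) \<le> (LINT x|lborel. cmod (g x))"
proof -
  have "cmod (LINT x|lborel. cis (f x) * g x) \<le> (LINT x|lborel. cmod (cis (f x) * g x))"
    by (rule integral_norm_bound)
  thus ?thesis by (simp add: norm_mult)
qed

lemma fourier_continuous: "integrable lborel g \<Longrightarrow> continuous_on UNIV (fourier g)"
  using continuous_cis_integral[of g "-1"] by (simp add: fourier_def[abs_def])

lemma inv_fourier_continuous: "integrable lborel g \<Longrightarrow> continuous_on UNIV (inv_fourier g)"
  using continuous_cis_integral[of g 1] unfolding inv_fourier_def[abs_def]
  by (intro continuous_intros) (simp add: inner_commute)

lemma fourier_bound: "cmod (fourier g x) \<le> (LINT x|lborel. cmod (g x))"
  unfolding fourier_def by (rule cis_integral_bound)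

lemma inv_fourier_bound:
  fixes g :: "'a::euclidean_space \<Rightarrow> complex"
  shows "cmod (inv_fourier g x) \<le> 1 / (2 * pi) ^ DIM('a) * (LINT x|lborel. cmod (g x))"
  unfolding inv_fourier_def norm_mult
  by (intro mult_mono cis_integral_bound) (auto simp: norm_divide norm_mult norm_power)

lemma integrable_mult_bounded:
  fixes f g :: "'a::euclidean_space \<Rightarrow> complex"
  assumes "integrable lborel f" "continuous_on UNIV g" "\<And>x. cmod (g x) \<le> B"
  shows "integrable lborel (\<lambda>x. f x * g x)"
proof (rule Bochner_Integration.integrable_bound)
  show "integrable lborel (\<lambda>x. complex_of_real B * f x)" using assms by simp
  show "AE x in lborel. cmod (f x * g x) \<le> cmod (complex_of_real B * f x)"
  proof (intro AE_I2)
    fix x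
    have b: "cmod (g x) \<le> \<bar>B\<bar>" using assms(3)[of x] by simp
    show "cmod (f x * g x) \<le> cmod (complex_of_real B * f x)"
      using mult_left_mono[OF b norm_ge_zero[of "f x"]] by (simp add: norm_mult mult.commute)
  qed
  show "(\<lambda>x. f x * g x) \<in> borel_measurable lborel"
    using borel_measurable_integrable[OF assms(1)] borel_measurable_continuous_onI[OF assms(2)] by simp
qed

text \<open>No Fourier inversion enters here, only Fubini: moving both transforms off \<open>\<phi>\<close> produces
  the forward transform of \<open>F\<close> and the inverse transform of its localisation.\<close>

lemma box_fun_pairing:
  fixes F :: "'a::euclidean_space \<Rightarrow> complex"
  assumes \<eta>: "bump \<eta>" and k: "k \<in> int_lattice" and F: "integrable lborel F"
    and T: "\<And>\<theta> B. continuous_on UNIV \<theta> \<Longrightarrow> (\<And>x. cmod (\<theta> x) \<le> B) \<Longrightarrow> T \<theta> = pairing F \<theta>"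
  shows "box_fun \<eta> k T = inv_fourier (\<lambda>\<xi>. complex_of_real (psi \<eta> k \<xi>) * fourier F \<xi>)" (is "_ = inv_fourier ?G")
proof -
  have \<psi>: "integrable lborel (\<lambda>\<xi>. complex_of_real (psi \<eta> k \<xi>))"
    using psi_integrable[OF \<eta> k] by simp
  have G: "integrable lborel ?G"
    by (rule integrable_mult_bounded[OF \<psi> fourier_continuous[OF F] fourier_bound])
  have rep: "represents (inv_fourier ?G) (box_op \<eta> k T)"
    unfolding represents_def
  proof (intro allI impI conjI)
    fix \<phi> :: "'a \<Rightarrow> complex" assume s: "schwartz \<phi>"
    note \<phi> = schwartz_integrable[OF s]
    show "integrable lborel (\<lambda>x. inv_fourier ?G x * \<phi> x)"
      using integrable_mult_bounded[OF \<phi> inv_fourier_continuous[OF G] inv_fourier_bound]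
      by (simp add: mult.commute)
    let ?\<chi> = "\<lambda>\<xi>. complex_of_real (psi \<eta> k \<xi>) * inv_fourier \<phi> \<xi>"
    have \<chi>: "integrable lborel ?\<chi>"
      by (rule integrable_mult_bounded[OF \<psi> inv_fourier_continuous[OF \<phi>] inv_fourier_bound])
    \<comment> \<open>\<open>T\<close> is applied to the transform of an integrable function, which
      is continuous and bounded; this is the class on which \<open>T\<close> is assumed to be a
      pairing, so no Schwartz estimates for \<open>?\<chi>\<close> enter.\<close>
    have "box_op \<eta> k T \<phi> = pairing F (fourier ?\<chi>)"
      unfolding box_op_def dist_inv_fourier_def dist_mult_def dist_fourier_def
      by (rule T[OF fourier_continuous[OF \<chi>] fourier_bound])
    also have "\<dots> = (LINT x|lborel. F x * (LINT y|lborel. cis (- (y \<bullet> x)) * ?\<chi> y))"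
      by (simp add: pairing_def fourier_def)
    also have "\<dots> = (LINT y|lborel. ?\<chi> y * (LINT x|lborel. cis (- (y \<bullet> x)) * F x))"
      by (rule fubini_bounded_kernel[OF F \<chi>]) (simp_all add: split_beta')
    also have "\<dots> = of_real (1 / (2 * pi) ^ DIM('a)) *
        (LINT y|lborel. ?G y * (LINT x|lborel. cis (y \<bullet> x) * \<phi> x))"
      by (subst integral_mult_right_zero[symmetric], intro Bochner_Integration.integral_cong refl)
        (simp add: fourier_def inv_fourier_def inner_commute mult_ac)
    also have "(LINT y|lborel. ?G y * (LINT x|lborel. cis (y \<bullet> x) * \<phi> x)) =
        (LINT x|lborel. \<phi> x * (LINT y|lborel. cis (y \<bullet> x) * ?G y))"
      by (rule fubini_bounded_kernel[OF G \<phi>]) (simp_all add: split_beta')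
    also have "of_real (1 / (2 * pi) ^ DIM('a)) * \<dots> = pairing (inv_fourier ?G) \<phi>"
      unfolding pairing_def
      by (subst integral_mult_right_zero[symmetric], intro Bochner_Integration.integral_cong refl)
        (simp add: inv_fourier_def inner_commute mult_ac)
    finally show "box_op \<eta> k T \<phi> = pairing (inv_fourier ?G) \<phi>" .
  qed
  show ?thesis unfolding box_fun_def
  proof (rule the_equality)
    show "continuous_on UNIV (inv_fourier ?G) \<and> represents (inv_fourier ?G) (box_op \<eta> k T)"
      using rep inv_fourier_continuous[OF G] by blast
    fix g assume g: "continuous_on UNIV g \<and> represents g (box_op \<eta> k T)"
    have "g x - inv_fourier ?G x = 0" for x
    proof (rule continuous_zero_if_pairing_zero[OF \<eta>, of "\<lambda>x. g x - inv_fourier ?G x"])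
      show "continuous_on UNIV (\<lambda>x. g x - inv_fourier ?G x)"
        using g inv_fourier_continuous[OF G] by (intro continuous_intros) auto
      fix \<phi> :: "'a \<Rightarrow> complex" assume s: "schwartz \<phi>"
      have i: "integrable lborel (\<lambda>x. g x * \<phi> x)" "integrable lborel (\<lambda>x. inv_fourier ?G x * \<phi> x)"
        "pairing g \<phi> = pairing (inv_fourier ?G) \<phi>"
        using g rep s unfolding represents_def by auto
      show "integrable lborel (\<lambda>x. (g x - inv_fourier ?G x) * \<phi> x)"
        using i by (simp add: left_diff_distrib)
      show "pairing (\<lambda>x. g x - inv_fourier ?G x) \<phi> = 0"
        using i by (simp add: pairing_def left_diff_distrib)
    qed
    thus "g = inv_fourier ?G" by auto
  qed
qed


section \<open>Wave packets\<close>

definition rho_ift :: "(real \<Rightarrow> real) \<Rightarrow> real \<Rightarrow> complex" where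
  "rho_ift \<eta> = inv_fourier (\<lambda>s. complex_of_real (rho \<eta> s))"

definition rho2_ift :: "(real \<Rightarrow> real) \<Rightarrow> real \<Rightarrow> real \<Rightarrow> real \<Rightarrow> complex" where
  "rho2_ift \<eta> k j = inv_fourier (\<lambda>s. complex_of_real (rho \<eta> (s - k) * rho \<eta> (s - j)))"

text \<open>The function g of the introductory text, already factored into one-dimensional inverse
  transforms.\<close>

definition atom :: "(real \<Rightarrow> real) \<Rightarrow> 'a::euclidean_space \<Rightarrow> complex" where
  "atom \<eta> x = (\<Prod>b\<in>Basis. rho_ift \<eta> (x \<bullet> b))"

text \<open>For lattice points k and l: the piece at k of the packet with frequency l, that is, the
  inverse transform of the product of \<open>psi \<eta> k\<close> and
  \<open>psi \<eta> l\<close>.\<close>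

definition box_atom :: "(real \<Rightarrow> real) \<Rightarrow> 'a::euclidean_space \<Rightarrow> 'a \<Rightarrow> 'a \<Rightarrow> complex" where
  "box_atom \<eta> k l x = (\<Prod>b\<in>Basis. rho2_ift \<eta> (k \<bullet> b) (l \<bullet> b) (x \<bullet> b))"

text \<open>For a lattice point l, all cells that a packet of frequency l can meet.\<close>

definition near :: "'a::euclidean_space \<Rightarrow> 'a set" where
  "near l = {k \<in> int_lattice. \<forall>b\<in>Basis. \<bar>k \<bullet> b - l \<bullet> b\<bar> \<le> 1}"

lemma inv_fourier_real_shift:
  fixes h :: "real \<Rightarrow> complex"
  shows "inv_fourier (\<lambda>s. h (s - k)) t = cis (k * t) * inv_fourier h t"
proof -
  have "(LINT s|lborel. cis (t * s) * h (s - k)) = (LINT s|lborel. cis (t * (k + s)) * h s)"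
    by (subst lborel_integral_real_affine[where c=1 and t=k]) auto
  also have "\<dots> = (LINT s|lborel. cis (k * t) * (cis (t * s) * h s))"
    by (intro Bochner_Integration.integral_cong refl)
      (simp add: distrib_left cis_mult[symmetric] mult_ac)
  also have "\<dots> = cis (k * t) * (LINT s|lborel. cis (t * s) * h s)" by simp
  finally show ?thesis by (simp add: inv_fourier_def)
qed

context
  fixes \<eta> :: "real \<Rightarrow> real"
  assumes \<eta>: "bump \<eta>"
begin

lemma rho_shift_C2: "C2 (\<lambda>s. rho \<eta> (s - d))"
  using C2_affine[OF rho_C2[OF \<eta>], of 1 "-d"] by simp

lemma rho2_integrable: "integrable lborel (\<lambda>s. rho \<eta> (s - k) * rho \<eta> (s - d))"
  by (rule integrable_C2_compact[of _ "\<bar>k\<bar> + 1"])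
    (auto intro!: C2_mult rho_shift_C2 simp: rho_zero[OF \<eta>])

text \<open>Uniformity in i and j is the point. A common translation costs only a unimodular factor,
  so only the integer j - i matters; if it is at least 2 in modulus, the product vanishes, which
  leaves three constants to add up.\<close>

lemma rho2_ift_decay:
  obtains K where "K \<ge> 0" "\<And>i j t. i \<in> \<int> \<Longrightarrow> j \<in> \<int> \<Longrightarrow> cmod (rho2_ift \<eta> i j t) \<le> K / (1 + t\<^sup>2)"
proof -
  have sh: "rho2_ift \<eta> k j t = cis (k * t) * rho2_ift \<eta> 0 (j - k) t" for k j t
    unfolding rho2_ift_def
    using inv_fourier_real_shift[of "\<lambda>s. complex_of_real (rho \<eta> s * rho \<eta> (s - (j - k)))" k t]
    by (simp add: algebra_simps)
  have "\<exists>K\<ge>0. \<forall>t. cmod (rho2_ift \<eta> 0 d t) \<le> K / (1 + t\<^sup>2)" for d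
    unfolding rho2_ift_def using rho_shift_C2[of 0]
    by (intro inv_fourier_C2_decay[of _ 1] C2_mult rho_shift_C2) (simp_all add: rho_zero[OF \<eta>])
  then obtain K where K: "\<And>d. K d \<ge> 0" "\<And>d t. cmod (rho2_ift \<eta> 0 d t) \<le> K d / (1 + t\<^sup>2)" by metis
  define M where "M = K (-1) + K 0 + K 1"
  show ?thesis
  proof
    show "M \<ge> 0" using K(1) by (simp add: M_def)
    fix i j t :: real assume "i \<in> \<int>" "j \<in> \<int>"
    then obtain d where d: "j - i = of_int d" by (metis Ints_diff Ints_cases)
    have "cmod (rho2_ift \<eta> i j t) = cmod (rho2_ift \<eta> 0 (of_int d) t)" by (simp add: sh[of i j] norm_mult d)
    also have "\<dots> \<le> M / (1 + t\<^sup>2)"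
    proof (cases "\<bar>d\<bar> \<le> 1")
      case True
      hence "d = -1 \<or> d = 0 \<or> d = 1" by auto
      hence "K (of_int d) \<le> M" using K(1)[of "-1"] K(1)[of 0] K(1)[of 1] by (auto simp: M_def)
      hence "K (of_int d) / (1 + t\<^sup>2) \<le> M / (1 + t\<^sup>2)" by (intro divide_right_mono) (auto simp: add_pos_nonneg)
      thus ?thesis using K(2) order_trans by blast
    next
      case False
      have "rho \<eta> s * rho \<eta> (s - of_int d) = 0" for s
      proof -
        have "\<bar>of_int d :: real\<bar> \<ge> 2" using False by linarith
        hence "\<bar>s\<bar> \<ge> 1 \<or> \<bar>s - of_int d\<bar> \<ge> 1" by linarith
        thus ?thesis using rho_zero[OF \<eta>] by auto
      qed
      hence "complex_of_real (rho \<eta> (s - 0) * rho \<eta> (s - of_int d)) = 0" for s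
        by (simp only: diff_zero of_real_0)
      hence "rho2_ift \<eta> 0 (of_int d) t = 0"
        by (simp only: rho2_ift_def inv_fourier_def mult_zero_right Bochner_Integration.integral_zero)
      thus ?thesis using \<open>M \<ge> 0\<close> by (simp add: add_nonneg_nonneg)
    qed
    finally show "cmod (rho2_ift \<eta> i j t) \<le> M / (1 + t\<^sup>2)" .
  qed
qed

lemma rho_ift_integrable: "integrable lborel (rho_ift \<eta>)"
proof -
  obtain K where K: "\<And>t. cmod (rho_ift \<eta> t) \<le> K / (1 + t\<^sup>2)"
    unfolding rho_ift_def using inv_fourier_C2_decay[OF rho_C2[OF \<eta>] rho_zero[OF \<eta>]] by metis
  have c: "continuous_on UNIV (rho_ift \<eta>)" unfolding rho_ift_def
    using integrable_rho_shift[OF \<eta>, of 0] by (intro inv_fourier_continuous) simp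
  show ?thesis
  proof (rule Bochner_Integration.integrable_bound[OF integrable_mult_right[OF integrable_inverse_square, of K]])
    show "AE t in lborel. cmod (rho_ift \<eta> t) \<le> norm (K * (1 / (1 + t\<^sup>2)))"
    proof (rule AE_I2)
      fix t show "cmod (rho_ift \<eta> t) \<le> norm (K * (1 / (1 + t\<^sup>2)))"
        using K[of t] abs_ge_self[of "K * (1 / (1 + t\<^sup>2))"] by simp
    qed
  qed (use c in \<open>simp add: borel_measurable_continuous_onI\<close>)
qed

text \<open>The one place where Fourier inversion enters: packets are built by an inverse transform,
  whereas their localisation is expressed through the forward one.\<close>

lemma fourier_rho_ift: "fourier (rho_ift \<eta>) \<xi> = complex_of_real (rho \<eta> \<xi>)"
proof -
  have c: "continuous_on UNIV (rho \<eta>)" by (rule C2_continuous[OF rho_C2[OF \<eta>]])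
  obtain B where B: "\<And>t. t \<in> {-1..1} \<Longrightarrow> norm (rho \<eta> t) \<le> B"
  proof -
    have "bounded (rho \<eta> ` {-1..1})"
      by (intro compact_imp_bounded compact_continuous_image continuous_on_subset[OF c]) auto
    thus thesis using that unfolding bounded_iff by (meson imageI)
  qed
  have "cmod (complex_of_real (rho \<eta> t)) \<le> max B 0" for t
    using B[of t] rho_zero[OF \<eta>, of t] by (cases "\<bar>t\<bar> \<ge> 1") (auto simp: abs_if split: if_splits)
  thus ?thesis
    unfolding rho_ift_def
    using c integrable_rho_shift[OF \<eta>, of 0] rho_ift_integrable[unfolded rho_ift_def]
    by (intro fourier_inv_fourier) (auto intro!: continuous_intros)
qed

lemma atom_integrable: "integrable lborel (atom \<eta>)"
  unfolding atom_def[abs_def] by (rule integrable_lborel_prod) (rule rho_ift_integrable)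

lemma modulated_atom_integrable: "integrable lborel (\<lambda>x. cis (l \<bullet> x) * atom \<eta> x)"
  by (rule integrable_cis_mult[OF atom_integrable]) simp

lemma fourier_modulated_atom:
  "fourier (\<lambda>x. cis (l \<bullet> x) * atom \<eta> x) \<xi> = (\<Prod>b\<in>Basis. complex_of_real (rho \<eta> (\<xi> \<bullet> b - l \<bullet> b)))"
proof -
  have "fourier (\<lambda>x. cis (l \<bullet> x) * atom \<eta> x) \<xi> = fourier (atom \<eta>) (\<xi> - l)"
    unfolding fourier_def mult.assoc[symmetric] cis_mult
    by (intro Bochner_Integration.integral_cong refl) (simp add: inner_diff_right inner_commute)
  also have "\<dots> = (\<Prod>b\<in>Basis. fourier (rho_ift \<eta>) ((\<xi> - l) \<bullet> b))"
    unfolding atom_def[abs_def] by (rule fourier_prod) (rule rho_ift_integrable)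
  finally show ?thesis by (simp add: fourier_rho_ift inner_diff_left)
qed

lemma inv_fourier_shifted_rho:
  "inv_fourier (\<lambda>\<xi>. \<Prod>b\<in>Basis. complex_of_real (rho \<eta> (\<xi> \<bullet> b - l \<bullet> b))) x = cis (l \<bullet> x) * atom \<eta> x"
proof -
  have "inv_fourier (\<lambda>\<xi>. \<Prod>b\<in>Basis. complex_of_real (rho \<eta> (\<xi> \<bullet> b - l \<bullet> b))) x =
      (\<Prod>b\<in>Basis. inv_fourier (\<lambda>t. complex_of_real (rho \<eta> (t - l \<bullet> b))) (x \<bullet> b))"
    by (rule inv_fourier_prod) (use integrable_rho_shift[OF \<eta>] in simp)
  also have "\<dots> = (\<Prod>b\<in>Basis. cis ((l \<bullet> b) * (x \<bullet> b)) * rho_ift \<eta> (x \<bullet> b))"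
    unfolding rho_ift_def by (intro prod.cong refl inv_fourier_real_shift)
  also have "\<dots> = cis (l \<bullet> x) * atom \<eta> x"
    by (subst euclidean_inner) (simp add: cis_sum prod.distrib atom_def)
  finally show ?thesis .
qed

lemma inv_fourier_box_atom:
  assumes "k \<in> int_lattice"
  shows "inv_fourier (\<lambda>\<xi>. complex_of_real (psi \<eta> k \<xi>) * (\<Prod>b\<in>Basis. complex_of_real (rho \<eta> (\<xi> \<bullet> b - l \<bullet> b)))) x
    = box_atom \<eta> k l x"
proof -
  have "inv_fourier (\<lambda>\<xi>. complex_of_real (psi \<eta> k \<xi>) * (\<Prod>b\<in>Basis. complex_of_real (rho \<eta> (\<xi> \<bullet> b - l \<bullet> b)))) x
    = inv_fourier (\<lambda>\<xi>. \<Prod>b\<in>Basis. complex_of_real (rho \<eta> (\<xi> \<bullet> b - k \<bullet> b) * rho \<eta> (\<xi> \<bullet> b - l \<bullet> b))) x"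
    by (simp add: psi_prod[OF \<eta> assms] prod.distrib)
  also have "\<dots> = box_atom \<eta> k l x"
    unfolding box_atom_def rho2_ift_def
    by (rule inv_fourier_prod[where f="\<lambda>b t. complex_of_real (rho \<eta> (t - k \<bullet> b) * rho \<eta> (t - l \<bullet> b))"])
      (intro integrable_of_real rho2_integrable)
  finally show ?thesis .
qed

lemma box_atom_integrand:
  assumes "k \<in> int_lattice"
  shows "integrable lborel (\<lambda>\<xi>. complex_of_real (psi \<eta> k \<xi>) * (\<Prod>b\<in>Basis. complex_of_real (rho \<eta> (\<xi> \<bullet> b - l \<bullet> b))))"
proof -
  have "integrable lborel (\<lambda>\<xi>. complex_of_real (psi \<eta> k \<xi>) * fourier (\<lambda>x. cis (l \<bullet> x) * atom \<eta> x) \<xi>)"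
    by (rule integrable_mult_bounded[OF _ fourier_continuous[OF modulated_atom_integrable] fourier_bound])
      (simp add: psi_integrable[OF \<eta> assms])
  thus ?thesis by (simp add: fourier_modulated_atom)
qed

lemma box_atom_continuous: "k \<in> int_lattice \<Longrightarrow> continuous_on UNIV (box_atom \<eta> k l)"
  using inv_fourier_continuous[OF box_atom_integrand, of k l]
  by (simp add: inv_fourier_box_atom cong: continuous_on_cong)

text \<open>In each coordinate at most three integers lie within distance 1 of that of l. This count
  is the overlap constant behind the almost orthogonality of the packets.\<close>

lemma near_card:
  fixes l :: "'a::euclidean_space"
  shows "finite (near l)" "card (near l) \<le> 3 ^ DIM('a)"
proof -
  let ?P = "PiE (Basis::'a set) (\<lambda>b. {\<lceil>l \<bullet> b\<rceil> - 1..\<lceil>l \<bullet> b\<rceil> + 1})"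
  let ?f = "\<lambda>k::'a. restrict (\<lambda>b. \<lfloor>k \<bullet> b\<rfloor>) Basis"
  have inj: "inj_on ?f (near l)"
  proof (rule inj_onI)
    fix k m assume *: "k \<in> near l" "m \<in> near l" "?f k = ?f m"
    show "k = m"
    proof (rule euclidean_eqI)
      fix b :: 'a assume b: "b \<in> Basis"
      have "\<lfloor>k \<bullet> b\<rfloor> = \<lfloor>m \<bullet> b\<rfloor>" using fun_cong[OF *(3), of b] b by simp
      thus "k \<bullet> b = m \<bullet> b"
        using int_lattice_floor[OF _ b, of k] int_lattice_floor[OF _ b, of m] *(1,2) unfolding near_def by auto
    qed
  qed
  have sub: "?f ` near l \<subseteq> ?P"
  proof (safe intro!: PiE_I)
    fix k b assume k: "k \<in> near l" and b: "(b::'a) \<in> Basis"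
    have "\<bar>k \<bullet> b - l \<bullet> b\<bar> \<le> 1" using k b by (simp add: near_def)
    moreover have "of_int \<lfloor>k \<bullet> b\<rfloor> = k \<bullet> b" using int_lattice_floor[OF _ b, of k] k by (simp add: near_def)
    ultimately have "\<bar>of_int \<lfloor>k \<bullet> b\<rfloor> - l \<bullet> b\<bar> \<le> 1" by (simp only:)
    hence "\<lfloor>k \<bullet> b\<rfloor> \<in> {\<lceil>l \<bullet> b\<rceil> - 1..\<lceil>l \<bullet> b\<rceil> + 1}" by simp linarith
    thus "?f k b \<in> {\<lceil>l \<bullet> b\<rceil> - 1..\<lceil>l \<bullet> b\<rceil> + 1}" using b by simp
  qed auto
  have fin: "finite ?P" by (intro finite_PiE) auto
  show "finite (near l)" using inj_on_finite[OF inj sub fin] .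
  have "card (near l) \<le> card ?P" using card_inj_on_le[OF inj sub fin] .
  also have "\<dots> = 3 ^ DIM('a)" by (subst card_PiE) auto
  finally show "card (near l) \<le> 3 ^ DIM('a)" .
qed

text \<open>Integer coordinates more than 1 apart are at least 2 apart; two translates of
  \<open>rho\<close> so far apart have no common point where both are nonzero, because
  \<open>rho\<close> vanishes already at -1 and 1.\<close>

lemma box_atom_far:
  assumes "k \<in> int_lattice" "l \<in> int_lattice" "k \<notin> near l"
  shows "psi \<eta> k \<xi> * (\<Prod>b\<in>Basis. rho \<eta> (\<xi> \<bullet> b - l \<bullet> b)) = 0" "box_atom \<eta> k l x = 0"
proof -
  obtain b where b: "b \<in> Basis" "\<bar>k \<bullet> b - l \<bullet> b\<bar> > 1" using assms unfolding near_def by force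
  have "\<bar>\<lfloor>k \<bullet> b\<rfloor> - \<lfloor>l \<bullet> b\<rfloor>\<bar> \<ge> 2"
    using b int_lattice_floor[OF assms(1) b(1)] int_lattice_floor[OF assms(2) b(1)] by linarith
  hence 2: "\<bar>k \<bullet> b - l \<bullet> b\<bar> \<ge> 2"
    using int_lattice_floor[OF assms(1) b(1)] int_lattice_floor[OF assms(2) b(1)] by linarith
  have z: "rho \<eta> (\<xi> \<bullet> b - k \<bullet> b) * rho \<eta> (\<xi> \<bullet> b - l \<bullet> b) = 0" for \<xi>
  proof -
    have "\<bar>\<xi> \<bullet> b - k \<bullet> b\<bar> \<ge> 1 \<or> \<bar>\<xi> \<bullet> b - l \<bullet> b\<bar> \<ge> 1" using 2 by linarith
    thus ?thesis using rho_zero[OF \<eta>] by auto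
  qed
  have z': "psi \<eta> k \<xi> * (\<Prod>b\<in>Basis. rho \<eta> (\<xi> \<bullet> b - l \<bullet> b)) = 0" for \<xi>
    unfolding psi_prod[OF \<eta> assms(1)] prod.distrib[symmetric] using z b(1) by (auto simp: prod_zero_iff)
  thus "psi \<eta> k \<xi> * (\<Prod>b\<in>Basis. rho \<eta> (\<xi> \<bullet> b - l \<bullet> b)) = 0" .
  have "inv_fourier (\<lambda>\<xi>. complex_of_real (psi \<eta> k \<xi> * (\<Prod>b\<in>Basis. rho \<eta> (\<xi> \<bullet> b - l \<bullet> b)))) x = 0"
    by (simp only: z' inv_fourier_def) simp
  thus "box_atom \<eta> k l x = 0" using inv_fourier_box_atom[OF assms(1), of l x] by simp
qed

text \<open>On the spectrum of the packet the functions \<open>psi \<eta> k\<close> with k in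
  \<open>near l\<close> add up to 1, so finitely many pieces reassemble it. This evaluates the trace
  series in closed form.\<close>

lemma box_atom_sum:
  assumes "l \<in> int_lattice"
  shows "(\<Sum>k\<in>near l. box_atom \<eta> k l x) = cis (l \<bullet> x) * atom \<eta> x"
proof -
  let ?H = "\<lambda>\<xi>. \<Prod>b\<in>Basis. complex_of_real (rho \<eta> (\<xi> \<bullet> b - l \<bullet> b))"
  have L: "k \<in> int_lattice" if "k \<in> near l" for k using that by (simp add: near_def)
  have "(\<Sum>k\<in>near l. complex_of_real (psi \<eta> k \<xi>) * ?H \<xi>) = ?H \<xi>" for \<xi>
  proof (cases "?H \<xi> = 0")
    case True
    show ?thesis unfolding True by simp
  next
    case False
    have "(\<Sum>k\<in>near l. psi \<eta> k \<xi>) = 1"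
    proof (rule psi_sum[OF \<eta> near_card(1)])
      fix k assume k: "k \<in> int_lattice - near l"
      have "psi \<eta> k \<xi> * (\<Prod>b\<in>Basis. rho \<eta> (\<xi> \<bullet> b - l \<bullet> b)) = 0"
        using k by (intro box_atom_far(1) assms) auto
      thus "psi \<eta> k \<xi> = 0" using False by auto
    qed (use L in auto)
    thus ?thesis by (simp only: sum_distrib_right[symmetric] of_real_sum[symmetric]) simp
  qed
  hence eq: "cis (x \<bullet> \<xi>) * ?H \<xi> = (\<Sum>k\<in>near l. cis (x \<bullet> \<xi>) * (complex_of_real (psi \<eta> k \<xi>) * ?H \<xi>))" for \<xi>
    by (simp only: sum_distrib_left[symmetric])
  have "inv_fourier ?H x = (\<Sum>k\<in>near l. inv_fourier (\<lambda>\<xi>. complex_of_real (psi \<eta> k \<xi>) * ?H \<xi>) x)"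
    unfolding inv_fourier_def sum_distrib_left[symmetric] unfolding eq
    by (subst Bochner_Integration.integral_sum)
      (auto intro!: integrable_cis_mult box_atom_integrand L)
  thus ?thesis by (simp add: inv_fourier_shifted_rho inv_fourier_box_atom L)
qed

text \<open>Stated for a functional that acts as such a pairing on bounded continuous functions, so
  that it covers both the wave and its trace, the latter being available only as a
  functional.\<close>

lemma box_fun_superposition:
  fixes l :: "'j \<Rightarrow> 'a::euclidean_space" and c :: "'j \<Rightarrow> complex"
  assumes k: "k \<in> int_lattice" and J: "finite J"
    and T: "\<And>\<theta> B. continuous_on UNIV \<theta> \<Longrightarrow> (\<And>x. cmod (\<theta> x) \<le> B) \<Longrightarrow>
      T \<theta> = pairing (\<lambda>x. \<Sum>j\<in>J. c j * (cis (l j \<bullet> x) * atom \<eta> x)) \<theta>"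
  shows "box_fun \<eta> k T = (\<lambda>x. \<Sum>j\<in>J. c j * box_atom \<eta> k (l j) x)"
proof -
  let ?F = "\<lambda>x. \<Sum>j\<in>J. c j * (cis (l j \<bullet> x) * atom \<eta> x)"
  let ?H = "\<lambda>j \<xi>. \<Prod>b\<in>Basis. complex_of_real (rho \<eta> (\<xi> \<bullet> b - l j \<bullet> b))"
  have i: "integrable lborel (\<lambda>x. c j * (cis (l j \<bullet> x) * atom \<eta> x))" for j
    by (intro integrable_mult_right modulated_atom_integrable)
  have "box_fun \<eta> k T = inv_fourier (\<lambda>\<xi>. complex_of_real (psi \<eta> k \<xi>) * fourier ?F \<xi>)"
    by (rule box_fun_pairing[OF \<eta> k _ T]) (auto intro!: i)
  moreover have "fourier ?F \<xi> = (\<Sum>j\<in>J. c j * ?H j \<xi>)" for \<xi>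
  proof -
    have "fourier ?F \<xi> = (LINT x|lborel. (\<Sum>j\<in>J. c j * (cis (- (x \<bullet> \<xi>)) * (cis (l j \<bullet> x) * atom \<eta> x))))"
      unfolding fourier_def by (intro Bochner_Integration.integral_cong refl) (simp add: sum_distrib_left mult_ac)
    also have "\<dots> = (\<Sum>j\<in>J. c j * fourier (\<lambda>x. cis (l j \<bullet> x) * atom \<eta> x) \<xi>)"
      by (subst Bochner_Integration.integral_sum)
        (auto simp: fourier_def intro!: integrable_mult_right integrable_cis_mult[of "\<lambda>x. cis (l j \<bullet> x) * atom \<eta> x" for j] modulated_atom_integrable)
    finally show ?thesis by (simp add: fourier_modulated_atom)
  qed
  moreover have "inv_fourier (\<lambda>\<xi>. complex_of_real (psi \<eta> k \<xi>) * (\<Sum>j\<in>J. c j * ?H j \<xi>)) x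
      = (\<Sum>j\<in>J. c j * box_atom \<eta> k (l j) x)" for x
  proof -
    let ?C = "complex_of_real (1 / (2 * pi) ^ DIM('a))"
    have "inv_fourier (\<lambda>\<xi>. complex_of_real (psi \<eta> k \<xi>) * (\<Sum>j\<in>J. c j * ?H j \<xi>)) x
      = ?C * (LINT \<xi>|lborel. (\<Sum>j\<in>J. c j * (cis (x \<bullet> \<xi>) * (complex_of_real (psi \<eta> k \<xi>) * ?H j \<xi>))))"
      unfolding inv_fourier_def
      by (intro arg_cong2[where f="(*)"] Bochner_Integration.integral_cong refl) (simp add: sum_distrib_left mult_ac)
    also have "\<dots> = (\<Sum>j\<in>J. c j * inv_fourier (\<lambda>\<xi>. complex_of_real (psi \<eta> k \<xi>) * ?H j \<xi>) x)"
      by (subst Bochner_Integration.integral_sum)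
        (auto simp: inv_fourier_def sum_distrib_left mult_ac intro!: integrable_mult_right integrable_cis_mult[OF box_atom_integrand[OF k]])
    finally show ?thesis by (simp add: inv_fourier_box_atom[OF k])
  qed
  ultimately show ?thesis by (simp add: fun_eq_iff)
qed

text \<open>The integral of \<open>rho\<close> over 2 pi. It is the factor that a packet acquires
  when restricted to x_n = 0, so its positivity keeps the trace from vanishing.\<close>

lemma rho_ift_0: "\<exists>r>0. rho_ift \<eta> 0 = complex_of_real r"
proof (intro exI conjI)
  let ?I = "LINT s|lborel. rho \<eta> s"
  have "?I \<noteq> 0" using continuous_nonneg_integral_0[of "rho \<eta>" 0] rho_0[OF \<eta>] rho_nonneg[OF \<eta>]
      C2_continuous[OF rho_C2[OF \<eta>]] integrable_rho_shift[OF \<eta>, of 0] by auto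
  moreover have "?I \<ge> 0" by (intro Bochner_Integration.integral_nonneg rho_nonneg[OF \<eta>])
  ultimately show "1 / (2 * pi) * ?I > 0" by simp
  show "rho_ift \<eta> 0 = complex_of_real (1 / (2 * pi) * ?I)" by (simp add: rho_ift_def inv_fourier_def)
qed

lemma rho2_ift_0: "rho2_ift \<eta> 0 0 0 \<noteq> 0"
proof -
  let ?f = "\<lambda>s. rho \<eta> s * rho \<eta> s"
  have "(LINT s|lborel. ?f s) \<noteq> 0"
    using continuous_nonneg_integral_0[of ?f 0] rho_0[OF \<eta>] rho2_integrable[of 0 0]
      C2_continuous[OF rho_C2[OF \<eta>], of UNIV] by (auto intro!: continuous_intros)
  moreover have "rho2_ift \<eta> 0 0 0 = complex_of_real (1 / (2 * pi) * (LINT s|lborel. ?f s))"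
    by (simp add: rho2_ift_def inv_fourier_def flip: integral_complex_of_real of_real_mult)
  ultimately show ?thesis by simp
qed

lemma box_atom_0: "box_atom \<eta> 0 0 0 \<noteq> 0"
  by (simp add: box_atom_def rho2_ift_0 prod_zero_iff)

end


section \<open>Norms and traces\<close>

lemma enn_powr_le: "x \<le> ennreal c \<Longrightarrow> 0 \<le> c \<Longrightarrow> 0 \<le> a \<Longrightarrow> enn_powr x a \<le> ennreal (c powr a)"
  by (cases x) (auto simp: enn_powr_def top_unique intro!: ennreal_leI powr_mono2)

lemma enn_powr_ge: "ennreal c \<le> x \<Longrightarrow> 0 \<le> c \<Longrightarrow> 0 \<le> a \<Longrightarrow> ennreal (c powr a) \<le> enn_powr x a"
  by (cases x) (auto simp: enn_powr_def intro!: ennreal_leI powr_mono2)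

abbreviation decay :: "'a::euclidean_space \<Rightarrow> real" where
  "decay x \<equiv> \<Prod>b\<in>Basis. 1 / (1 + (x \<bullet> b)\<^sup>2)"

lemma decay_bounds: "0 < decay x" "decay x \<le> 1"
proof -
  have "1 \<le> 1 + (x \<bullet> b)\<^sup>2" for b by simp
  hence "0 < 1 / (1 + (x \<bullet> b)\<^sup>2) \<and> 1 / (1 + (x \<bullet> b)\<^sup>2) \<le> 1" for b
    by (simp add: add_pos_nonneg)
  thus "0 < decay x" "decay x \<le> 1" by (auto intro!: prod_pos prod_le_1 simp: less_imp_le)
qed

text \<open>One constant serves every p: since 0 < \<open>decay\<close> \<le> 1, its powers with
  exponent above 1 are at most \<open>decay\<close>, and a number that is at least 1 dominates its
  own r-th root.\<close>

lemma Lp_norm_le: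
  assumes p: "1 < p" and g: "g \<in> borel_measurable borel" and M: "0 \<le> M"
    and b: "\<And>x::'a::euclidean_space. cmod (g x) \<le> M * decay x"
  shows "Lp_norm p g \<le> ennreal (M * max 1 (LINT x|lborel. decay (x::'a)))" (is "_ \<le> ennreal (M * ?\<kappa>)")
proof (cases "p = \<infinity>")
  case True
  have "cmod (g x) \<le> M * ?\<kappa>" for x
  proof -
    have "M * decay x \<le> M * 1" using decay_bounds[of x] M by (intro mult_left_mono) auto
    also have "\<dots> \<le> M * ?\<kappa>" using M by (intro mult_left_mono) auto
    finally show ?thesis using b[of x] by linarith
  qed
  hence "esssup lborel (\<lambda>x. ennreal (cmod (g x))) \<le> ennreal (M * ?\<kappa>)"
    using g by (intro esssup_I AE_I2 ennreal_leI) auto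
  thus ?thesis using True by (simp add: Lp_norm_def)
next
  case False
  define r where "r = enn2real p"
  have r: "1 < r" using p False unfolding r_def by (cases p) auto
  have "(\<integral>\<^sup>+ x. ennreal (cmod (g x) powr r) \<partial>lborel) \<le> (\<integral>\<^sup>+ x. ennreal (M powr r * decay (x::'a)) \<partial>lborel)"
  proof (intro nn_integral_mono ennreal_leI)
    fix x
    have "cmod (g x) powr r \<le> (M * decay x) powr r" using r b by (intro powr_mono2) auto
    also have "\<dots> = M powr r * decay x powr r"
      by (rule powr_mult)
    also have "decay x powr r \<le> decay x powr 1"
      using decay_bounds[of x] r by (intro powr_mono') auto
    hence "M powr r * decay x powr r \<le> M powr r * decay x"
      using decay_bounds[of x] by (intro mult_left_mono) (auto simp: powr_one)
    finally show "cmod (g x) powr r \<le> M powr r * decay x" .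
  qed
  also have "\<dots> = ennreal (LINT x|lborel. M powr r * decay (x::'a))"
    by (intro nn_integral_eq_integral integrable_mult_right integrable_prod_inverse_square
        AE_I2 mult_nonneg_nonneg less_imp_le[OF decay_bounds(1)]) auto
  also have "\<dots> \<le> ennreal (M powr r * ?\<kappa>)"
    by (intro ennreal_leI) (auto intro!: mult_left_mono)
  finally have "Lp_norm p g \<le> ennreal ((M powr r * ?\<kappa>) powr (1 / r))"
    using False r by (simp add: Lp_norm_def r_def[symmetric]) (intro enn_powr_le, auto)
  also have "(M powr r * ?\<kappa>) powr (1 / r) = M * ?\<kappa> powr (1 / r)"
    using r M by (simp add: powr_mult powr_powr)
  also have "ennreal \<dots> \<le> ennreal (M * ?\<kappa>)"
  proof -
    have "?\<kappa> powr (1 / r) \<le> ?\<kappa> powr 1" using r by (intro powr_mono) auto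
    thus ?thesis using M by (intro ennreal_leI mult_left_mono) auto
  qed
  finally show ?thesis .
qed

text \<open>The counterpart of the upper bound: a number in [0, 1] is at most its own r-th root,
  whence the minimum with 1. For p = \<infinity> it suffices that a ball is not a null set.\<close>

lemma Lp_norm_ge:
  assumes p: "1 < p" and g: "g \<in> borel_measurable borel" and c: "0 \<le> c" and r0: "0 < r0"
    and b: "\<And>x::'a::euclidean_space. x \<in> ball 0 r0 \<Longrightarrow> c \<le> cmod (g x)"
  shows "ennreal (c * min 1 (measure lborel (ball (0::'a) r0))) \<le> Lp_norm p g" (is "ennreal (c * ?\<kappa>) \<le> _")
proof (cases "p = \<infinity>")
  case True
  have "ennreal c \<le> esssup lborel (\<lambda>x. ennreal (cmod (g x)))" (is "_ \<le> ?E")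
  proof (rule ccontr)
    assume *: "\<not> ?thesis"
    have "AE x in lborel. ennreal (cmod (g x)) \<le> ?E" by (rule esssup_AE)
    hence "AE x in lborel. x \<notin> ball (0::'a) r0"
    proof eventually_elim
      case (elim x)
      thus ?case using * b[of x] by (meson ennreal_leI order_trans)
    qed
    hence "ball (0::'a) r0 \<in> null_sets lborel" by (subst AE_iff_null_sets) auto
    hence "negligible (ball (0::'a) r0)" by (simp add: negligible_iff_null_sets null_sets_completionI)
    thus False using open_not_negligible[of "ball (0::'a) r0"] r0 by auto
  qed
  moreover have "c * ?\<kappa> \<le> c" using c by (simp add: mult_left_le)
  ultimately show ?thesis using True by (simp add: Lp_norm_def) (meson ennreal_leI order_trans)
next
  case False
  define r where "r = enn2real p"
  have r: "1 < r" using p False unfolding r_def by (cases p) auto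
  let ?m = "measure lborel (ball (0::'a) r0)"
  have "ennreal (c powr r * ?m) = (\<integral>\<^sup>+ x. ennreal (c powr r) * indicator (ball (0::'a) r0) x \<partial>lborel)"
    using emeasure_lborel_ball_finite[of "0::'a" r0]
    by (simp add: nn_integral_cmult_indicator ennreal_mult emeasure_eq_ennreal_measure)
  also have "\<dots> \<le> (\<integral>\<^sup>+ x. ennreal (cmod (g x) powr r) \<partial>lborel)"
    using r c b by (intro nn_integral_mono) (auto simp: indicator_def intro!: ennreal_leI powr_mono2)
  finally have "ennreal ((c powr r * ?m) powr (1 / r)) \<le> Lp_norm p g"
    using False r by (simp add: Lp_norm_def r_def[symmetric]) (intro enn_powr_ge, auto)
  moreover have "c * ?\<kappa> \<le> (c powr r * ?m) powr (1 / r)"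
  proof -
    have "?\<kappa> \<le> ?\<kappa> powr (1 / r)"
      using r powr_mono'[of "1 / r" 1 ?\<kappa>] by simp
    also have "\<dots> \<le> ?m powr (1 / r)" using r by (intro powr_mono2) auto
    finally have "c * ?\<kappa> \<le> c * ?m powr (1 / r)" using c by (intro mult_left_mono)
    also have "\<dots> = (c powr r * ?m) powr (1 / r)" using r c by (simp add: powr_mult powr_powr)
    finally show ?thesis .
  qed
  ultimately show ?thesis by (meson ennreal_leI order_trans)
qed

lemma zero_int_lattice: "0 \<in> int_lattice" by (simp add: int_lattice_def)

lemma mod_norm_ge:
  fixes f :: "'a::euclidean_space distribution"
  assumes q: "1 < q" and c: "0 \<le> c" "ennreal c \<le> Lp_norm p (box_fun \<eta> 0 f)"
  shows "ennreal c \<le> mod_norm \<eta> p q 0 f"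
proof (cases "q = \<infinity>")
  case True
  have "ennreal c \<le> ennreal (japanese (0::'a) powr 0) * Lp_norm p (box_fun \<eta> 0 f)"
    using c by (simp add: japanese_def)
  thus ?thesis using True unfolding mod_norm_def by (auto intro!: SUP_upper2[OF zero_int_lattice])
next
  case False
  define r where "r = enn2real q"
  have r: "1 < r" using q False unfolding r_def by (cases q) auto
  let ?t = "\<lambda>k::'a. ennreal (japanese k powr (r * 0)) * enn_powr (Lp_norm p (box_fun \<eta> k f)) r"
  have "ennreal (c powr r) \<le> ?t 0"
    using enn_powr_ge[OF c(2,1), of r] r by (simp add: japanese_def)
  also have "\<dots> = infsum ?t {0}" by simp
  also have "\<dots> \<le> infsum ?t int_lattice"
    by (rule infsum_mono_neutral) (auto simp: zero_int_lattice intro: nonneg_summable_on_complete)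
  finally have "ennreal ((c powr r) powr (1 / r)) \<le> enn_powr (infsum ?t int_lattice) (1 / r)"
    using r by (intro enn_powr_ge) auto
  moreover have "(c powr r) powr (1 / r) = c" using r c by (simp add: powr_powr)
  ultimately show ?thesis using False by (simp add: mod_norm_def r_def)
qed

lemma tempered_pairing:
  fixes F :: "'a::euclidean_space \<Rightarrow> complex"
  assumes F: "integrable lborel F"
  shows "tempered (pairing F)"
proof -
  have i: "integrable lborel (\<lambda>x. F x * \<phi> x)" if "schwartz \<phi>" for \<phi>
    using integrable_mult_bounded[OF F schwartz_continuous[OF that] schwartz_norm_0[OF that]] .
  have "cmod (pairing F \<phi>) \<le> (LINT x|lborel. cmod (F x)) * schwartz_norm 0 \<phi>" if s: "schwartz \<phi>" for \<phi>
  proof -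
    have "cmod (pairing F \<phi>) \<le> (LINT x|lborel. cmod (F x * \<phi> x))"
      unfolding pairing_def by (rule integral_norm_bound)
    also have "\<dots> \<le> (LINT x|lborel. cmod (F x) * schwartz_norm 0 \<phi>)"
      using F i[OF s]
      by (intro integral_mono integrable_norm integrable_mult_left)
        (auto simp: norm_mult intro!: mult_left_mono schwartz_norm_0 s)
    finally show ?thesis by simp
  qed
  thus ?thesis unfolding tempered_def
    by (auto simp: pairing_def distrib_left i mult.left_commute)
qed

section \<open>Restriction to the hyperplane x_n = 0\<close>

lemma prod_Basis_prod:
  "(\<Prod>b\<in>(Basis :: ('a::euclidean_space \<times> real) set). f b) = (\<Prod>b\<in>Basis. f (b, 0)) * f (0, 1)"
proof -
  have "(\<Prod>b\<in>(Basis :: ('a \<times> real) set). f b) = (\<Prod>b\<in>(\<lambda>u. (u, 0)) ` Basis. f b) * (\<Prod>b\<in>{(0, 1)}. f b)"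
    unfolding Basis_prod_def by (subst prod.union_disjoint) auto
  also have "(\<Prod>b\<in>(\<lambda>u. (u, 0)) ` (Basis :: 'a set). f b) = (\<Prod>b\<in>Basis. f (b, 0))"
    by (subst prod.reindex) (auto simp: inj_on_def)
  finally show ?thesis by simp
qed

lemma box_atom_bound:
  assumes "bump \<eta>"
  obtains M where "0 \<le> M"
    "\<And>k l x::'a::euclidean_space. k \<in> int_lattice \<Longrightarrow> l \<in> int_lattice \<Longrightarrow> cmod (box_atom \<eta> k l x) \<le> M * decay x"
proof -
  obtain K where K: "K \<ge> 0" "\<And>i j t. i \<in> \<int> \<Longrightarrow> j \<in> \<int> \<Longrightarrow> cmod (rho2_ift \<eta> i j t) \<le> K / (1 + t\<^sup>2)"
    using rho2_ift_decay[OF assms] by blast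
  show thesis
  proof
    show "0 \<le> K ^ DIM('a)" using K by simp
    fix k l x :: 'a assume "k \<in> int_lattice" "l \<in> int_lattice"
    hence "cmod (box_atom \<eta> k l x) \<le> (\<Prod>b\<in>Basis. K * (1 / (1 + (x \<bullet> b)\<^sup>2)))"
      unfolding box_atom_def prod_norm[symmetric] by (intro prod_mono) (simp add: K(2) int_lattice_def)
    thus "cmod (box_atom \<eta> k l x) \<le> K ^ DIM('a) * decay x"
      by (simp only: prod.distrib prod_constant)
  qed
qed

lemma slice_integrable:
  fixes k l :: "'a::euclidean_space \<times> real"
  assumes \<eta>: "bump \<eta>" and kl: "k \<in> int_lattice" "l \<in> int_lattice"
  shows "integrable lborel (\<lambda>x. box_atom \<eta> k l (x, 0))"
proof -
  obtain M where M: "0 \<le> M"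
    "\<And>k l x::'a \<times> real. k \<in> int_lattice \<Longrightarrow> l \<in> int_lattice \<Longrightarrow> cmod (box_atom \<eta> k l x) \<le> M * decay x"
    using box_atom_bound[OF \<eta>] by blast
  \<comment> \<open>The last factor of the decay is 1 at x_n = 0, so the majorant restricts to the
    one on the hyperplane.\<close>
  have "cmod (box_atom \<eta> k l (x, 0)) \<le> M * decay x" for x
    using M(2)[OF kl, of "(x, 0)"] by (simp add: prod_Basis_prod)
  moreover have "continuous_on UNIV (\<lambda>x. box_atom \<eta> k l (x, 0))"
    by (intro continuous_on_compose2[OF box_atom_continuous[OF \<eta> kl(1)]] continuous_intros) auto
  ultimately show ?thesis
    by (intro Bochner_Integration.integrable_bound[OF integrable_mult_right[OF integrable_prod_inverse_square, of M]])
      (auto intro!: borel_measurable_continuous_onI AE_I2 intro: order_trans[OF _ abs_ge_self] simp del: abs_mult)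
qed

text \<open>The frequencies lie on the last axis, so the modulation is 1 on the hyperplane: all
  packets have the same restriction and their coefficients add without cancellation. Testing on
  bounded continuous functions allows the result to be localised again.\<close>

lemma Tr_superposition:
  fixes l :: "'j \<Rightarrow> 'a::euclidean_space \<times> real" and c :: "'j \<Rightarrow> complex"
  assumes \<eta>: "bump \<eta>" and J: "finite J" and l: "\<And>j. l j \<in> int_lattice" "\<And>j. fst (l j) = 0"
    and \<theta>: "continuous_on UNIV \<theta>" "\<And>x. cmod (\<theta> x) \<le> B"
  shows "Tr \<eta> (pairing (\<lambda>x. \<Sum>j\<in>J. c j * (cis (l j \<bullet> x) * atom \<eta> x))) \<theta> =
    pairing (\<lambda>x. (\<Sum>j\<in>J. c j) * rho_ift \<eta> 0 * atom \<eta> x) \<theta>"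
proof -
  let ?f = "pairing (\<lambda>x. \<Sum>j\<in>J. c j * (cis (l j \<bullet> x) * atom \<eta> x))"
  define A where "A k j = (LINT x|lborel. box_atom \<eta> k (l j) (x, 0) * \<theta> x)" for k j
  have i: "integrable lborel (\<lambda>x. box_atom \<eta> k (l j) (x, 0) * \<theta> x)" if "k \<in> int_lattice" for k j
    by (rule integrable_mult_bounded[OF slice_integrable[OF \<eta> that l(1)] \<theta>])
  have tt: "trace_term \<eta> ?f k \<theta> = (\<Sum>j\<in>J. c j * A k j)" if k: "k \<in> int_lattice" for k
  proof -
    have "trace_term \<eta> ?f k \<theta> = (LINT x|lborel. (\<Sum>j\<in>J. c j * (box_atom \<eta> k (l j) (x, 0) * \<theta> x)))"
      unfolding trace_term_def pairing_def
      by (subst box_fun_superposition[OF \<eta> k J, of _ c l]) (simp_all add: pairing_def sum_distrib_right mult.assoc)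
    also have "\<dots> = (\<Sum>j\<in>J. c j * A k j)"
      unfolding A_def using i[OF k] by (subst Bochner_Integration.integral_sum) auto
    finally show ?thesis .
  qed
  define K where "K = (\<Union>j\<in>J. near (l j))"
  have K: "finite K" "K \<subseteq> int_lattice" unfolding K_def using J near_card(1)[OF \<eta>] by (auto simp: near_def)
  have A0: "A k j = 0" if "k \<in> int_lattice" "k \<notin> near (l j)" for k j
    using box_atom_far(2)[OF \<eta> that(1) l(1) that(2)] by (simp add: A_def)
  have "Tr \<eta> ?f \<theta> = (\<Sum>\<^sub>\<infinity>k\<in>int_lattice. \<Sum>j\<in>J. c j * A k j)"
    unfolding Tr_def by (intro infsum_cong tt)
  also have "\<dots> = (\<Sum>\<^sub>\<infinity>k\<in>K. \<Sum>j\<in>J. c j * A k j)"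
    using K by (intro infsum_cong_neutral) (auto simp: K_def A0 intro!: sum.neutral)
  also have "\<dots> = (\<Sum>j\<in>J. \<Sum>k\<in>K. c j * A k j)" using K(1) by (simp add: sum.swap[of _ K])
  also have "\<dots> = (\<Sum>j\<in>J. c j * (rho_ift \<eta> 0 * (LINT x|lborel. atom \<eta> x * \<theta> x)))"
  proof (intro sum.cong refl)
    fix j assume j: "j \<in> J"
    have L: "k \<in> int_lattice" if "k \<in> near (l j)" for k using that by (simp add: near_def)
    have "(\<Sum>k\<in>K. A k j) = (\<Sum>k\<in>near (l j). A k j)"
      using K j by (intro sum.mono_neutral_right) (auto simp: K_def intro!: A0)
    also have "\<dots> = (LINT x|lborel. (\<Sum>k\<in>near (l j). box_atom \<eta> k (l j) (x, 0)) * \<theta> x)"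
      unfolding A_def sum_distrib_right by (subst Bochner_Integration.integral_sum) (auto intro!: i L)
    also have "\<dots> = (LINT x|lborel. rho_ift \<eta> 0 * (atom \<eta> x * \<theta> x))"
      using l(2)[of j]
      by (simp add: box_atom_sum[OF \<eta> l(1)] inner_prod_def atom_def prod_Basis_prod mult_ac)
    finally show "(\<Sum>k\<in>K. c j * A k j) = c j * (rho_ift \<eta> 0 * (LINT x|lborel. atom \<eta> x * \<theta> x))"
      by (simp add: sum_distrib_left[symmetric])
  qed
  also have "\<dots> = pairing (\<lambda>x. (\<Sum>j\<in>J. c j) * rho_ift \<eta> 0 * atom \<eta> x) \<theta>"
    by (simp add: pairing_def mult.assoc sum_distrib_right[symmetric])
  finally show ?thesis .
qed


section \<open>The counterexample\<close>

lemma axis_int_lattice: "(0, real j) \<in> (int_lattice :: ('a::euclidean_space \<times> real) set)"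
  by (auto simp: int_lattice_def Basis_prod_def inner_prod_def)

lemma near_axis:
  fixes k :: "'a::euclidean_space \<times> real"
  assumes "k \<in> near (0, real j)"
  shows "\<bar>snd k - real j\<bar> \<le> 1" "snd k \<in> \<int>" "\<And>b. b \<in> Basis \<Longrightarrow> \<bar>fst k \<bullet> b\<bar> \<le> 1"
proof -
  have "(0, 1) \<in> (Basis :: ('a \<times> real) set)" by (simp add: Basis_prod_def)
  thus "\<bar>snd k - real j\<bar> \<le> 1" "snd k \<in> \<int>"
    using assms unfolding near_def int_lattice_def by (force simp: inner_prod_def)+
  fix b :: 'a assume "b \<in> Basis"
  hence "(b, 0) \<in> (Basis :: ('a \<times> real) set)" by (simp add: Basis_prod_def)
  thus "\<bar>fst k \<bullet> b\<bar> \<le> 1"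
    using assms unfolding near_def by (force simp: inner_prod_def)
qed

text \<open>The transverse coordinates are at most 1 in modulus, so the last one governs the weight.
  The shift by 1 is there because a cell near (0, 1) may have last coordinate 0.\<close>

lemma japanese_near_axis:
  fixes k :: "'a::euclidean_space \<times> real"
  assumes "k \<in> near (0, real j)" "1 \<le> j"
  shows "japanese k \<le> (1 + real DIM('a)) * (snd k + 1)"
proof -
  note n = near_axis[OF assms(1)]
  have s: "snd k \<ge> 0" using n(1) assms(2) by linarith
  have "norm (fst k) \<le> (\<Sum>b\<in>(Basis::'a set). 1)"
    by (rule order_trans[OF norm_le_l1 sum_mono]) (rule n(3))
  moreover have "norm k \<le> norm (fst k) + norm (snd k)"
    by (metis norm_Pair_le prod.collapse)
  moreover have "japanese k \<le> 1 + norm k"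
    unfolding japanese_def by (rule real_le_lsqrt) (auto simp: power2_sum)
  ultimately have "japanese k \<le> 1 + real DIM('a) + snd k" using s by simp
  also have "\<dots> \<le> (1 + real DIM('a)) * (snd k + 1)" using s by (simp add: algebra_simps)
  finally show ?thesis .
qed

text \<open>The 9 is 3 * 3: at most three j are within 1 of \<open>snd k\<close>, and for each of
  them \<open>snd k + 1\<close> \<le> j + 2 \<le> 3 j.\<close>

lemma axis_weight_sum:
  fixes k :: "'a::euclidean_space \<times> real"
  assumes "k \<in> near (0, real j0)" "1 \<le> j0"
  shows "(\<Sum>j\<in>{1..N}. if k \<in> near (0, real j) then 1 / real j else 0) \<le> 9 / (snd k + 1)"
proof -
  note n0 = near_axis[OF assms(1)]
  have s: "snd k \<ge> 0" using n0(1) assms(2) by linarith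
  obtain i where i: "snd k = of_int i" using n0(2) by (auto elim: Ints_cases)
  let ?S = "{j\<in>{1..N}. k \<in> near (0, real j)}"
  have "card ?S \<le> card {i-1..i+1}"
  proof (rule card_inj_on_le[where f=int])
    show "int ` ?S \<subseteq> {i-1..i+1}"
    proof safe
      fix j assume "k \<in> near (0, real j)"
      from near_axis(1)[OF this] show "int j \<in> {i-1..i+1}" unfolding i by simp linarith
    qed
  qed auto
  hence card: "card ?S \<le> 3" by simp
  have "(\<Sum>j\<in>{1..N}. if k \<in> near (0, real j) then 1 / real j else 0) = (\<Sum>j\<in>?S. 1 / real j)"
    by (simp add: sum.If_cases Int_def)
  also have "\<dots> \<le> (\<Sum>j\<in>?S. 3 / (snd k + 1))"
  proof (rule sum_mono)
    fix j assume j: "j \<in> ?S"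
    hence "snd k + 1 \<le> 3 * real j" using near_axis(1)[of k j] by auto
    thus "1 / real j \<le> 3 / (snd k + 1)" using s j by (simp add: field_simps)
  qed
  also have "\<dots> = real (card ?S) * (3 / (snd k + 1))" by simp
  also have "\<dots> \<le> 3 * (3 / (snd k + 1))" using card s by (intro mult_right_mono) auto
  finally show ?thesis by simp
qed

definition wave :: "(real \<Rightarrow> real) \<Rightarrow> nat \<Rightarrow> 'a::euclidean_space \<times> real \<Rightarrow> complex" where
  "wave \<eta> N x = (\<Sum>j\<in>{1..N}. complex_of_real (1 / real j) * (cis ((0, real j) \<bullet> x) * atom \<eta> x))"

lemma wave_integrable: "bump \<eta> \<Longrightarrow> integrable lborel (wave \<eta> N)"
  unfolding wave_def[abs_def]
  by (intro Bochner_Integration.integrable_sum integrable_mult_right modulated_atom_integrable)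

text \<open>Here 1 - \<tau> is 1/q'. The bound is exactly of order H_N^\<tau> because the q-th
  powers of the weighted pieces are comparable to 1 / (k_n + 1), and each j accounts for boundedly
  many cells.\<close>

lemma mod_norm_wave_le:
  fixes p q :: ennreal and \<tau> :: real
  assumes \<eta>: "bump \<eta>" and p: "1 < p" and q: "1 < q"
    and \<tau>: "\<tau> = (if q = \<infinity> then 0 else 1 / enn2real q)"
  obtains B where "0 \<le> B" "\<And>N. 1 \<le> N \<Longrightarrow>
    mod_norm \<eta> p q (1 - \<tau>) (pairing (wave \<eta> N :: 'a::euclidean_space \<times> real \<Rightarrow> complex)) \<le> ennreal (B * harm N powr \<tau>)"
proof -
  obtain M where M: "0 \<le> M" "\<And>k l x::'a \<times> real. k \<in> int_lattice \<Longrightarrow> l \<in> int_lattice \<Longrightarrow>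
      cmod (box_atom \<eta> k l x) \<le> M * decay x"
    using box_atom_bound[OF \<eta>] by blast
  define C0 where "C0 = M * max 1 (LINT x|lborel. decay (x::'a \<times> real))"
  \<comment> \<open>The factor 9 comes from \<open>axis_weight_sum\<close>, the dimension from
    \<open>japanese_near_axis\<close>, and \<open>C0\<close> from the L^p bound of one
    piece.\<close>
  define D where "D = 9 * (1 + real DIM('a)) * C0"
  have C0: "C0 \<ge> 0" using M(1) by (simp add: C0_def)
  have D0: "D \<ge> 0" using C0 by (simp add: D_def)
  have \<tau>01: "0 \<le> \<tau>" "\<tau> < 1"
  proof -
    have "1 < enn2real q" if "q \<noteq> \<infinity>" using q that by (cases q) auto
    thus "0 \<le> \<tau>" "\<tau> < 1" unfolding \<tau> by auto
  qed
  define l where "l j = (0 :: 'a, real j)" for j :: nat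
  have l: "l j \<in> int_lattice" for j unfolding l_def by (rule axis_int_lattice)
  define B where "B = D * 3 ^ (DIM('a) + 1)"
  have B0: "B \<ge> 0" using D0 by (simp add: B_def)
  have main: "mod_norm \<eta> p q (1 - \<tau>) (pairing (wave \<eta> N :: 'a \<times> real \<Rightarrow> complex)) \<le> ennreal (B * harm N powr \<tau>)"
    if N: "1 \<le> N" for N
  proof -
    let ?f = "pairing (wave \<eta> N :: 'a \<times> real \<Rightarrow> complex)"
    define A where "A k = (\<Sum>j\<in>{1..N}. if k \<in> near (l j) then 1 / real j else 0)" for k
    have A0: "A k \<ge> 0" for k unfolding A_def by (intro sum_nonneg) auto
    \<comment> \<open>For q = \<infinity> the bound contains \<open>harm N powr 0\<close>, which is
      1 only for a nonzero base.\<close>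
    have H1: "harm N \<ge> (1::real)"
    proof -
      have "harm 1 \<le> (harm N :: real)" unfolding harm_def using N by (intro sum_mono2) auto
      thus ?thesis by (simp add: harm_def)
    qed
    have Lp: "Lp_norm p (box_fun \<eta> k ?f) \<le> ennreal (A k * C0)" if k: "k \<in> int_lattice" for k
    proof -
      have eq: "box_fun \<eta> k ?f = (\<lambda>x. \<Sum>j\<in>{1..N}. complex_of_real (1 / real j) * box_atom \<eta> k (l j) x)"
        by (rule box_fun_superposition[OF \<eta> k]) (simp_all add: l_def wave_def[abs_def])
      have "cmod (box_fun \<eta> k ?f x) \<le> (A k * M) * decay x" for x
      proof -
        have "cmod (box_fun \<eta> k ?f x) \<le> (\<Sum>j\<in>{1..N}. cmod (complex_of_real (1 / real j) * box_atom \<eta> k (l j) x))"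
          unfolding eq by (rule norm_sum)
        also have "\<dots> \<le> (\<Sum>j\<in>{1..N}. (if k \<in> near (l j) then 1 / real j else 0) * (M * decay x))"
        proof (rule sum_mono)
          fix j
          show "cmod (complex_of_real (1 / real j) * box_atom \<eta> k (l j) x) \<le>
              (if k \<in> near (l j) then 1 / real j else 0) * (M * decay x)"
          proof (cases "k \<in> near (l j)")
            case True
            have "1 / real j * cmod (box_atom \<eta> k (l j) x) \<le> 1 / real j * (M * decay x)"
              by (intro mult_left_mono M(2) k l) simp
            thus ?thesis using True by (simp add: norm_mult norm_divide)
          next
            case False
            thus ?thesis using box_atom_far(2)[OF \<eta> k l False] by simp
          qed
        qed
        also have "\<dots> = (A k * M) * decay x"
          unfolding A_def sum_distrib_right by (simp add: mult.assoc)
        finally show ?thesis .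
      qed
      moreover have "box_fun \<eta> k ?f \<in> borel_measurable borel"
        unfolding eq
        by (intro borel_measurable_continuous_onI continuous_intros box_atom_continuous[OF \<eta> k, THEN continuous_on_subset]) auto
      ultimately have "Lp_norm p (box_fun \<eta> k ?f) \<le> ennreal ((A k * M) * max 1 (LINT x|lborel. decay (x::'a \<times> real)))"
        by (intro Lp_norm_le p mult_nonneg_nonneg A0 M(1))
      thus ?thesis by (simp add: C0_def mult.assoc)
    qed
    define K where "K = (\<Union>j\<in>{1..N}. near (l j))"
    have K: "finite K" "K \<subseteq> int_lattice" unfolding K_def using near_card(1)[OF \<eta>] by (auto simp: near_def)
    have AK: "A k = 0" if "k \<notin> K" for k using that unfolding A_def K_def by (intro sum.neutral) auto
    have sk: "snd k \<ge> 0" if kK: "k \<in> K" for k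
    proof -
      obtain j where "j \<ge> 1" "k \<in> near (l j)" using kK by (auto simp: K_def)
      thus ?thesis using near_axis(1)[of k j] by (auto simp: l_def)
    qed
    \<comment> \<open>The coefficients contribute (k_n + 1)^(-1) and the weight (k_n + 1)^(1 -
      \<tau>). For finite q, the q-th power of the product is a harmonic term.\<close>
    have w: "japanese k powr (1 - \<tau>) * (A k * C0) \<le> D * (snd k + 1) powr (- \<tau>)" if kK: "k \<in> K" for k
    proof -
      obtain j where j: "1 \<le> j" "k \<in> near (0, real j)" using kK by (auto simp: K_def l_def)
      note s = sk[OF kK]
      have n1: "1 \<le> 1 + real DIM('a)" by simp
      have "A k \<le> 9 / (snd k + 1)" unfolding A_def l_def by (rule axis_weight_sum[OF j(2,1)])
      hence a: "A k * C0 \<le> 9 / (snd k + 1) * C0" using C0 by (rule mult_right_mono)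
      have "japanese k powr (1 - \<tau>) \<le> ((1 + real DIM('a)) * (snd k + 1)) powr (1 - \<tau>)"
        using \<tau>01 japanese_ge_1[of k] by (intro powr_mono2 japanese_near_axis[OF j(2,1)]) auto
      also have "\<dots> = (1 + real DIM('a)) powr (1 - \<tau>) * (snd k + 1) powr (1 - \<tau>)"
        by (rule powr_mult)
      also have "\<dots> \<le> (1 + real DIM('a)) powr 1 * (snd k + 1) powr (1 - \<tau>)"
        using \<tau>01 by (intro mult_right_mono powr_mono) auto
      also have "(snd k + 1) powr (1 - \<tau>) = (snd k + 1) * (snd k + 1) powr (- \<tau>)"
        using s by (simp add: powr_diff powr_minus divide_inverse)
      finally have "japanese k powr (1 - \<tau>) \<le> (1 + real DIM('a)) * ((snd k + 1) * (snd k + 1) powr (- \<tau>))"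
        by simp
      hence "japanese k powr (1 - \<tau>) * (A k * C0) \<le>
          (1 + real DIM('a)) * ((snd k + 1) * (snd k + 1) powr (- \<tau>)) * (9 / (snd k + 1) * C0)"
        by (rule mult_mono[OF _ a]) (use s C0 A0 in auto)
      also have "\<dots> = D * (snd k + 1) powr (- \<tau>)" using s by (simp add: D_def field_simps)
      finally show ?thesis .
    qed
    show ?thesis
    proof (cases "q = \<infinity>")
      case True
      hence t0: "\<tau> = 0" by (simp add: \<tau>)
      have "ennreal (japanese k powr (1 - \<tau>)) * Lp_norm p (box_fun \<eta> k ?f) \<le> ennreal B" if k: "k \<in> int_lattice" for k
      proof -
        have "ennreal (japanese k powr (1 - \<tau>)) * Lp_norm p (box_fun \<eta> k ?f) \<le>
            ennreal (japanese k powr (1 - \<tau>)) * ennreal (A k * C0)"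
          by (intro mult_left_mono Lp k) simp
        also have "\<dots> = ennreal (japanese k powr (1 - \<tau>) * (A k * C0))" using A0 C0 by (simp add: ennreal_mult)
        also have "\<dots> \<le> ennreal B"
        proof (intro ennreal_leI)
          have DB: "D \<le> B" unfolding B_def using D0 mult_left_mono[OF one_le_power[of "3::real" "DIM('a) + 1"], of D] by simp
          show "japanese k powr (1 - \<tau>) * (A k * C0) \<le> B"
          proof (cases "k \<in> K")
            case True
            thus ?thesis using w[OF True] sk[OF True] DB by (simp add: t0)
          next
            case False
            thus ?thesis using B0 by (simp add: AK)
          qed
        qed
        finally show ?thesis .
      qed
      thus ?thesis using True H1 unfolding mod_norm_def t0 by (auto intro!: SUP_least)
    next
      case False
      define r where "r = enn2real q"
      have r: "1 < r" using q False unfolding r_def by (cases q) auto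
      have tr: "\<tau> = 1 / r" using False by (simp add: \<tau> r_def)
      let ?t = "\<lambda>k. ennreal (japanese k powr (r * (1 - \<tau>))) * enn_powr (Lp_norm p (box_fun \<eta> k ?f)) r"
      have tb: "?t k \<le> ennreal ((japanese k powr (1 - \<tau>) * (A k * C0)) powr r)" if k: "k \<in> int_lattice" for k
      proof -
        have "?t k \<le> ennreal (japanese k powr (r * (1 - \<tau>))) * ennreal ((A k * C0) powr r)"
          using r A0 C0 by (intro mult_left_mono enn_powr_le Lp k) auto
        also have "\<dots> = ennreal ((japanese k powr (1 - \<tau>) * (A k * C0)) powr r)"
          by (simp add: powr_mult powr_powr ennreal_mult mult.commute)
        finally show ?thesis .
      qed
      have "infsum ?t int_lattice = infsum ?t K"
      proof (rule infsum_cong_neutral)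
        fix k assume "k \<in> int_lattice - K"
        thus "?t k = 0" using tb[of k] by (simp add: AK)
      qed (use K in auto)
      also have "\<dots> = (\<Sum>k\<in>K. ?t k)" using K(1) by simp
      also have "\<dots> \<le> (\<Sum>k\<in>K. ennreal (D powr r * (1 / (snd k + 1))))"
      proof (rule sum_mono)
        fix k assume kK: "k \<in> K"
        have "(japanese k powr (1 - \<tau>) * (A k * C0)) powr r \<le> (D * (snd k + 1) powr (- \<tau>)) powr r"
          using r A0 C0 by (intro powr_mono2 w kK) auto
        also have "\<dots> = D powr r * (1 / (snd k + 1))"
          using r sk[OF kK] by (simp add: powr_mult powr_divide powr_powr tr powr_minus inverse_eq_divide)
        finally show "?t k \<le> ennreal (D powr r * (1 / (snd k + 1)))"
          using tb[of k] kK K(2) by (meson ennreal_leI order_trans subsetD)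
      qed
      also have "\<dots> = ennreal (\<Sum>k\<in>K. D powr r * (1 / (snd k + 1)))"
        using sk by (intro sum_ennreal) (auto intro!: mult_nonneg_nonneg divide_nonneg_nonneg add_nonneg_nonneg)
      also have "\<dots> \<le> ennreal (D powr r * (3 ^ (DIM('a) + 1) * harm N))"
      proof (intro ennreal_leI)
        \<comment> \<open>Double counting: every cell of \<open>K\<close> is charged to some j whose
          packet reaches it, with j \<le> \<open>snd k + 1\<close>; after swapping the sums, each j
          is charged at most 3^n times.\<close>
        have "(\<Sum>k\<in>K. 1 / (snd k + 1)) \<le> (\<Sum>k\<in>K. \<Sum>j\<in>{1..N}. if k \<in> near (l j) then 1 / real j else 0)"
        proof (rule sum_mono)
          fix k assume kK: "k \<in> K"
          then obtain j where j: "j \<in> {1..N}" "k \<in> near (l j)" by (auto simp: K_def)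
          have "real j \<le> snd k + 1" using near_axis(1)[of k j] j(2) by (auto simp: l_def)
          hence "1 / (snd k + 1) \<le> (if k \<in> near (l j) then 1 / real j else 0)"
            using j by (simp add: frac_le)
          also have "\<dots> \<le> (\<Sum>j\<in>{1..N}. if k \<in> near (l j) then 1 / real j else 0)"
            using j(1) by (intro member_le_sum) auto
          finally show "1 / (snd k + 1) \<le> (\<Sum>j\<in>{1..N}. if k \<in> near (l j) then 1 / real j else 0)" .
        qed
        also have "\<dots> = (\<Sum>j\<in>{1..N}. \<Sum>k\<in>K. if k \<in> near (l j) then 1 / real j else 0)"
          by (rule sum.swap)
        also have "\<dots> = (\<Sum>j\<in>{1..N}. real (card (near (l j))) * (1 / real j))"
        proof (rule sum.cong[OF refl])
          fix j assume "j \<in> {1..N}"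
          hence "K \<inter> near (l j) = near (l j)" by (auto simp: K_def)
          thus "(\<Sum>k\<in>K. if k \<in> near (l j) then 1 / real j else 0) = real (card (near (l j))) * (1 / real j)"
            using K(1) by (simp add: sum.If_cases)
        qed
        also have "\<dots> \<le> (\<Sum>j\<in>{1..N}. 3 ^ (DIM('a) + 1) * (1 / real j))"
        proof (intro sum_mono mult_right_mono)
          fix j show "real (card (near (l j))) \<le> 3 ^ (DIM('a) + 1)"
            using near_card(2)[OF \<eta>, of "l j"] by (metis DIM_prod DIM_real of_nat_le_iff of_nat_numeral of_nat_power)
        qed simp
        also have "\<dots> = 3 ^ (DIM('a) + 1) * harm N"
          by (simp add: sum_distrib_left harm_def inverse_eq_divide)
        finally show "(\<Sum>k\<in>K. D powr r * (1 / (snd k + 1))) \<le> D powr r * (3 ^ (DIM('a) + 1) * harm N)"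
          unfolding sum_distrib_left[symmetric] by (intro mult_left_mono) auto
      qed
      finally have "enn_powr (infsum ?t int_lattice) (1 / r) \<le>
          ennreal ((D powr r * (3 ^ (DIM('a) + 1) * harm N)) powr (1 / r))"
        using r H1 by (intro enn_powr_le) auto
      also have "(D powr r * (3 ^ (DIM('a) + 1) * harm N)) powr (1 / r) =
          D * ((3 ^ (DIM('a) + 1)) powr (1 / r) * harm N powr \<tau>)"
        using r D0 by (simp add: powr_mult powr_powr tr)
      also have "ennreal \<dots> \<le> ennreal (B * harm N powr \<tau>)"
      proof (intro ennreal_leI)
        \<comment> \<open>Dropping the root keeps \<open>B\<close> free of q; it is allowed because
          the base is at least 1.\<close>
        have "(3 ^ (DIM('a) + 1) :: real) powr (1 / r) \<le> (3 ^ (DIM('a) + 1)) powr 1"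
          using r by (intro powr_mono one_le_power) auto
        hence "(3 ^ (DIM('a) + 1) :: real) powr (1 / r) * harm N powr \<tau> \<le> 3 ^ (DIM('a) + 1) * harm N powr \<tau>"
          by (intro mult_right_mono) auto
        thus "D * ((3 ^ (DIM('a) + 1)) powr (1 / r) * harm N powr \<tau>) \<le> B * harm N powr \<tau>"
          unfolding B_def mult.assoc using D0 by (rule mult_left_mono)
      qed
      finally show ?thesis using False by (simp add: mod_norm_def r_def)
    qed
  qed
  show thesis by (rule that[OF B0 main])
qed

text \<open>The piece at k = 0 of the trace is H_N times a positive constant times the continuous
  function \<open>box_atom \<eta> 0 0\<close>, which is nonzero at the origin and so bounded below
  on a ball.\<close>

lemma mod_norm_trace_wave_ge:
  fixes p q :: ennreal
  assumes \<eta>: "bump \<eta>" and p: "1 < p" and q: "1 < q"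
  obtains c where "0 < c" "\<And>N. ennreal (c * harm N) \<le>
    mod_norm \<eta> p q 0 (Tr \<eta> (pairing (wave \<eta> N :: 'a::euclidean_space \<times> real \<Rightarrow> complex)))"
proof -
  obtain v where v: "v > 0" "rho_ift \<eta> 0 = complex_of_real v" using rho_ift_0[OF \<eta>] by blast
  let ?g = "box_atom \<eta> 0 0 :: 'a \<Rightarrow> complex"
  have gc: "continuous_on UNIV ?g" by (rule box_atom_continuous[OF \<eta> zero_int_lattice])
  define d where "d = cmod (?g 0) / 2"
  have d: "d > 0" "d < cmod (?g 0)" using box_atom_0[OF \<eta>, where 'a='a] by (auto simp: d_def)
  have "open {x. d < cmod (?g x)}" by (intro open_Collect_less continuous_intros gc)
  then obtain r0 where r0: "r0 > 0" "ball 0 r0 \<subseteq> {x. d < cmod (?g x)}" using d(2) openE by (metis mem_Collect_eq)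
  define \<kappa> where "\<kappa> = min 1 (measure lborel (ball (0::'a) r0))"
  have \<kappa>: "\<kappa> > 0" using r0(1) by (simp add: \<kappa>_def content_ball_pos)
  have main: "ennreal (v * d * \<kappa> * harm N) \<le> mod_norm \<eta> p q 0 (Tr \<eta> (pairing (wave \<eta> N :: 'a \<times> real \<Rightarrow> complex)))" for N
  proof -
    let ?T = "Tr \<eta> (pairing (wave \<eta> N :: 'a \<times> real \<Rightarrow> complex))"
    let ?H = "complex_of_real (harm N * v)"
    have h0: "harm N \<ge> (0::real)" by (rule harm_nonneg)
    have T: "?T \<theta> = pairing (\<lambda>x. ?H * (cis (0 \<bullet> x) * atom \<eta> x)) \<theta>"
      if "continuous_on UNIV \<theta>" "\<And>x. cmod (\<theta> x) \<le> B" for \<theta> B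
    proof -
      have "(\<Sum>j\<in>{1..N}. complex_of_real (1 / real j)) = complex_of_real (harm N)"
        by (simp add: harm_def inverse_eq_divide)
      moreover have "?T \<theta> = pairing (\<lambda>x. (\<Sum>j\<in>{1..N}. complex_of_real (1 / real j)) * rho_ift \<eta> 0 * atom \<eta> x) \<theta>"
        unfolding wave_def[abs_def]
        by (rule Tr_superposition[OF \<eta> _ _ _ that]) (simp_all add: axis_int_lattice)
      ultimately show ?thesis by (simp add: v(2))
    qed
    have eq: "box_fun \<eta> 0 ?T = (\<lambda>x. ?H * ?g x)"
    proof -
      \<comment> \<open>The trace is a superposition with a single packet, of frequency 0.\<close>
      have "box_fun \<eta> 0 ?T = (\<lambda>x. \<Sum>j\<in>{()}. ?H * box_atom \<eta> 0 0 x)"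
      proof (rule box_fun_superposition[OF \<eta> zero_int_lattice, where l="\<lambda>_. 0"])
        fix \<theta> :: "'a \<Rightarrow> complex" and B assume "continuous_on UNIV \<theta>" "\<And>x. cmod (\<theta> x) \<le> B"
        from T[OF this] show "?T \<theta> = pairing (\<lambda>x. \<Sum>j\<in>{()}. ?H * (cis (0 \<bullet> x) * atom \<eta> x)) \<theta>" by simp
      qed simp
      thus ?thesis by simp
    qed
    have "ennreal ((harm N * v * d) * \<kappa>) \<le> Lp_norm p (box_fun \<eta> 0 ?T)"
      unfolding \<kappa>_def
    proof (rule Lp_norm_ge[OF p _ _ r0(1)])
      show "box_fun \<eta> 0 ?T \<in> borel_measurable borel" unfolding eq
        by (intro borel_measurable_continuous_onI continuous_intros gc)
      show "0 \<le> harm N * v * d" using h0 v d by simp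
      fix x :: 'a assume "x \<in> ball 0 r0"
      hence "d \<le> cmod (?g x)" using r0(2) by auto
      thus "harm N * v * d \<le> cmod (box_fun \<eta> 0 ?T x)"
        unfolding eq using h0 v by (simp add: norm_mult mult_left_mono)
    qed
    thus ?thesis using h0 v d \<kappa> by (intro mod_norm_ge q) (simp_all add: mult_ac)
  qed
  show thesis using main v d \<kappa> by (intro that[of "v * d * \<kappa>"]) simp_all
qed

text \<open>The type \<open>real ^ 'm\<close> has dimension n - 1 \<ge> 1, since index types are
  nonempty; this encodes n \<ge> 2.\<close>

theorem mainTheorem4:
  fixes \<eta> :: "real \<Rightarrow> real" and p q q' :: ennreal
  assumes "bump \<eta>"
    and "1 < p" and "1 < q" and "1 / q + 1 / q' = 1"
  shows "\<not> (\<exists>C>0. \<forall>f :: ((real ^ 'm::finite) \<times> real) distribution.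
            f \<in> mod_space \<eta> p q (enn2real (1 / q')) \<longrightarrow>
              trace_defined \<eta> f \<and>
              mod_norm \<eta> p q 0 (Tr \<eta> f) \<le> ennreal C * mod_norm \<eta> p q (enn2real (1 / q')) f)"
proof (intro notI, elim exE conjE)
  fix C :: real
  assume C: "C > 0" and all: "\<forall>f :: ((real ^ 'm) \<times> real) distribution.
            f \<in> mod_space \<eta> p q (enn2real (1 / q')) \<longrightarrow>
              trace_defined \<eta> f \<and>
              mod_norm \<eta> p q 0 (Tr \<eta> f) \<le> ennreal C * mod_norm \<eta> p q (enn2real (1 / q')) f"
  define \<tau> where "\<tau> = (if q = \<infinity> then 0 else 1 / enn2real q)"
  have \<tau>: "\<tau> < 1" "enn2real (1 / q') = 1 - \<tau>"
  proof -
    have "\<tau> < 1 \<and> 1 / q = ennreal \<tau> \<and> 0 \<le> \<tau>"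
    proof (cases "q = \<infinity>")
      case False
      define r where "r = enn2real q"
      have r: "1 < r" "q = ennreal r" using assms(3) False unfolding r_def by (cases q; auto)+
      thus ?thesis using False by (simp add: \<tau>_def divide_ennreal flip: ennreal_1)
    qed (simp add: \<tau>_def)
    \<comment> \<open>In \<open>ennreal\<close> the equation forces \<open>1 / q'\<close> to be
      finite, after which it can be solved in the reals; 1/q is 0 for q = \<infinity>.\<close>
    moreover from this assms(4) obtain y where "1 / q' = ennreal y" "y \<ge> 0"
      by (cases "1 / q'") auto
    ultimately show "\<tau> < 1" "enn2real (1 / q') = 1 - \<tau>"
      using assms(4) by (auto simp flip: ennreal_plus ennreal_1)
  qed
  obtain B where B: "0 \<le> B" "\<And>N. 1 \<le> N \<Longrightarrow> mod_norm \<eta> p q (1 - \<tau>)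
      (pairing (wave \<eta> N :: (real ^ 'm) \<times> real \<Rightarrow> complex)) \<le> ennreal (B * harm N powr \<tau>)"
    using mod_norm_wave_le[OF assms(1-3) \<tau>_def] by blast
  obtain c where c: "0 < c" "\<And>N. ennreal (c * harm N) \<le>
      mod_norm \<eta> p q 0 (Tr \<eta> (pairing (wave \<eta> N :: (real ^ 'm) \<times> real \<Rightarrow> complex)))"
    using mod_norm_trace_wave_ge[OF assms(1-3)] by blast
  have ineq: "c * harm N \<le> C * B * harm N powr \<tau>" if N: "1 \<le> N" for N
  proof -
    let ?f = "pairing (wave \<eta> N :: (real ^ 'm) \<times> real \<Rightarrow> complex)"
    have "?f \<in> mod_space \<eta> p q (1 - \<tau>)"
      unfolding mod_space_def using tempered_pairing[OF wave_integrable[OF assms(1)]] B(2)[OF N]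
      by (auto simp: le_less_trans)
    hence "ennreal (c * harm N) \<le> ennreal C * mod_norm \<eta> p q (1 - \<tau>) ?f"
      using all c(2)[of N] order_trans unfolding \<tau>(2) by blast
    also have "\<dots> \<le> ennreal C * ennreal (B * harm N powr \<tau>)"
      by (intro mult_left_mono B(2) N) simp
    also have "\<dots> = ennreal (C * B * harm N powr \<tau>)"
      using C B(1) by (simp add: ennreal_mult mult.assoc)
    finally show ?thesis using C B(1) by (subst (asm) ennreal_le_iff) auto
  qed
  have lim: "filterlim (\<lambda>N. (harm N :: real)) at_top sequentially" by (rule harm_at_top)
  \<comment> \<open>The inequality c h \<le> C B h^\<tau> bounds h by the power shown here, so a
    harmonic number beyond \<open>Y\<close> contradicts it. The maximum with 1 keeps h positive for
    the division by h^\<tau>.\<close>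
  define Y where "Y = max 1 ((C * B / c) powr (1 / (1 - \<tau>)))"
  have "eventually (\<lambda>N. Y < harm N \<and> 1 \<le> N) sequentially"
    using filterlim_at_top_dense[THEN iffD1, OF lim] eventually_ge_at_top[of 1] by (auto intro: eventually_conj)
  then obtain N :: nat where N: "Y < harm N" "1 \<le> N" by (auto simp: eventually_at_top_linorder)
  define h :: real where "h = harm N"
  have h: "h > 0" using N by (auto simp: Y_def h_def)
  have "c * h powr (1 - \<tau>) = c * h / h powr \<tau>"
    using h by (simp add: powr_diff)
  also have "\<dots> \<le> C * B" using ineq[OF N(2), folded h_def] h by (subst pos_divide_le_eq) auto
  finally have "c * h powr (1 - \<tau>) \<le> C * B" .
  hence "h powr (1 - \<tau>) \<le> C * B / c" using c by (simp add: field_simps)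
  hence "(h powr (1 - \<tau>)) powr (1 / (1 - \<tau>)) \<le> (C * B / c) powr (1 / (1 - \<tau>))"
    using \<tau>(1) by (intro powr_mono2) auto
  hence "h \<le> (C * B / c) powr (1 / (1 - \<tau>))" using \<tau>(1) h by (simp add: powr_powr)
  thus False using N(1) by (simp add: Y_def h_def)
qed

end
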